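(* Let $h\in\mathcal H^{\rm BV}$ be continuous or strictly monotone on $[0,1]$. Then the following are equivalent: (i) $h$ is convex; (ii) $I_h$ is concave-order monotone; (iii) $I_h$ is o-superadditive; (iv) $I_h$ is o-concave; (v) $I_h$ is o-quasi-concave; (vi) $I_h$ is p-convex; (vii) $I_h$ is p-quasi-convex.
   Context: A distribution is a Borel probability measure on $\mathbb R$; $\mathcal M_c$ is the set of compactly supported distributions. Fix a nonatomic probability space $(\Omega,\mathcal F,\mathbb P)$; $\mathcal X_c$ is the set of random variables on it with distribution in $\mathcal M_c$. $\mathcal H^{\rm BV}$ is the set of functions $h:[0,1]\to\mathbb R$ of bounded variation with $h(0)=0$. "Strictly monotone" means strictly increasing or strictly decreasing. For $h\in\mathcal H^{\rm BV}$ and $F\in\mathcal M_c$, $I_h(F)=\int_0^\infty h(F((x,\infty)))\,dx+\int_{-\infty}^0\big(h(F((x,\infty)))-h(1)\big)\,dx$; for $X\in\mathcal X_c$, $I_h(X)$ denotes $I_h$ of the distribution of $X$. Definitions for $\rho=I_h$: concave-order monotone: $\rho(F)\le\rho(G)$ for all $F,G\in\mathcal M_c$ such that $\int f\,dF\le\int f\,dG$ for all concave $f:\mathbb R\to\mathbb R$; o-superadditive: $\rho(X+Y)\ge\rho(X)+\rho(Y)$ for all $X,Y\in\mathcal X_c$; o-concave: $\rho(\lambda X+(1-\lambda)Y)\ge\lambda\rho(X)+(1-\lambda)\rho(Y)$ for all $X,Y\in\mathcal X_c$, $\lambda\in[0,1]$; o-quasi-concave: $\rho(\lambda X+(1-\lambda)Y)\ge\min\{\rho(X),\rho(Y)\}$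 for all $X,Y\in\mathcal X_c$, $\lambda\in[0,1]$; p-convex: $\rho(\lambda F+(1-\lambda)G)\le\lambda\rho(F)+(1-\lambda)\rho(G)$ for all $F,G\in\mathcal M_c$, $\lambda\in[0,1]$; p-quasi-convex: $\rho(\lambda F+(1-\lambda)G)\le\max\{\rho(F),\rho(G)\}$ for all $F,G\in\mathcal M_c$, $\lambda\in[0,1]$. *)

theory Defs
  imports "HOL-Probability.Probability"
begin

definition bounded_variation_Icc :: "real \<Rightarrow> real \<Rightarrow> (real \<Rightarrow> real) \<Rightarrow> bool" where
  "bounded_variation_Icc a b h \<longleftrightarrow>
     (\<exists>B. \<forall>n (t :: nat \<Rightarrow> real). (\<forall>i\<le>n. t i \<in> {a..b}) \<and> mono_on {..n} t \<longrightarrow>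
        (\<Sum>i<n. \<bar>h (t (Suc i)) - h (t i)\<bar>) \<le> B)"

(* Functions on [0,1] are represented by total functions; values outside [0,1] are never used. *)
definition H_BV :: "(real \<Rightarrow> real) set" where
  "H_BV = {h. bounded_variation_Icc 0 1 h \<and> h 0 = 0}"

definition compact_distributions :: "real measure set" where
  "compact_distributions = {F. real_distribution F \<and> (\<exists>K. compact K \<and> measure F K = 1)}"

definition nonatomic :: "'a measure \<Rightarrow> bool" where
  "nonatomic M \<longleftrightarrow> (\<forall>A\<in>sets M. 0 < emeasure M A \<longrightarrow>
     (\<exists>B\<in>sets M. B \<subseteq> A \<and> 0 < emeasure M B \<and> emeasure M B < emeasure M A))"

definition compact_rvs :: "'a measure \<Rightarrow> ('a \<Rightarrow> real) set" where
  "compact_rvs M = {X \<in> borel_measurable M. distr M borel X \<in> compact_distributions}"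

(* For h in H_BV and F in compact_distributions both integrands are bounded, Borel measurable and
   vanish outside a compact set, so neither integral takes the default value 0 of
   non-integrable functions. *)
definition distortion_riskmetric :: "(real \<Rightarrow> real) \<Rightarrow> real measure \<Rightarrow> real" where
  "distortion_riskmetric h F =
     (LBINT x:{0..}. h (measure F {x<..})) + (LBINT x:{..0}. h (measure F {x<..}) - h 1)"

definition mixture :: "real \<Rightarrow> real measure \<Rightarrow> real measure \<Rightarrow> real measure" where
  "mixture \<alpha> F G = measure_of UNIV (sets borel)
     (\<lambda>A. ennreal \<alpha> * emeasure F A + ennreal (1 - \<alpha>) * emeasure G A)"

lemma sets_mixture [simp]: "sets (mixture \<alpha> F G) = sets borel"
  unfolding mixture_def by (metis sets.sets_measure_of_eq space_borel)

lemma space_mixture [simp]: "space (mixture \<alpha> F G) = UNIV"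
  by (simp add: mixture_def)

lemma emeasure_mixture:
  assumes "sets F = sets borel" "sets G = sets borel" "A \<in> sets borel"
  shows "emeasure (mixture \<alpha> F G) A = ennreal \<alpha> * emeasure F A + ennreal (1 - \<alpha>) * emeasure G A"
proof (rule emeasure_measure_of[OF mixture_def])
  show "countably_additive (sets (mixture \<alpha> F G))
      (\<lambda>A. ennreal \<alpha> * emeasure F A + ennreal (1 - \<alpha>) * emeasure G A)"
  proof (rule countably_additiveI)
    fix C :: "nat \<Rightarrow> real set"
    assume C: "range C \<subseteq> sets (mixture \<alpha> F G)" "disjoint_family C"
    have "(\<Sum>i. emeasure F (C i)) = emeasure F (\<Union>i. C i)"
         "(\<Sum>i. emeasure G (C i)) = emeasure G (\<Union>i. C i)"
      using C assms by (auto intro!: suminf_emeasure)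
    then show "(\<Sum>i. ennreal \<alpha> * emeasure F (C i) + ennreal (1 - \<alpha>) * emeasure G (C i)) =
        ennreal \<alpha> * emeasure F (\<Union>i. C i) + ennreal (1 - \<alpha>) * emeasure G (\<Union>i. C i)"
      by (simp flip: suminf_add)
  qed
qed (use assms in \<open>auto simp: positive_def\<close>)

lemma mixture_in_compact_distributions:
  assumes F: "F \<in> compact_distributions" and G: "G \<in> compact_distributions"
    and l: "\<alpha> \<in> {0..1}"
  shows "mixture \<alpha> F G \<in> compact_distributions"
proof -
  interpret F: real_distribution F using F by (simp add: compact_distributions_def)
  interpret G: real_distribution G using G by (simp add: compact_distributions_def)
  from F G obtain K L where KL: "compact K" "compact L" "measure F K = 1" "measure G L = 1"
    unfolding compact_distributions_def by blast
  then have B: "K \<in> sets borel" "L \<in> sets borel" by (auto intro: borel_compact)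
  have one: "emeasure (mixture \<alpha> F G) A = 1"
    if A: "A \<in> sets borel" and "measure F A = 1" "measure G A = 1" for A
    using that l
    by (simp add: emeasure_mixture F.emeasure_eq_measure G.emeasure_eq_measure flip: ennreal_plus)
  have "measure F (K \<union> L) \<ge> measure F K" "measure G (K \<union> L) \<ge> measure G L"
    using B by (auto intro!: F.finite_measure_mono G.finite_measure_mono)
  then have "measure F (K \<union> L) = 1" "measure G (K \<union> L) = 1"
    using KL F.prob_le_1 G.prob_le_1 by (metis order_antisym)+
  then have "emeasure (mixture \<alpha> F G) (K \<union> L) = 1" using one B by auto
  moreover have "emeasure (mixture \<alpha> F G) UNIV = 1"
    using one F.prob_space G.prob_space by auto
  ultimately show ?thesis
    using KL unfolding compact_distributions_def
    by (auto intro!: exI[of _ "K \<union> L"] prob_spaceI compact_Un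
        simp: measure_def real_distribution_def real_distribution_axioms_def)
qed

definition concave_order_monotone :: "(real measure \<Rightarrow> real) \<Rightarrow> bool" where
  "concave_order_monotone \<rho> \<longleftrightarrow>
     (\<forall>F\<in>compact_distributions. \<forall>G\<in>compact_distributions.
        (\<forall>f :: real \<Rightarrow> real. concave_on UNIV f \<longrightarrow> (LINT x|F. f x) \<le> (LINT x|G. f x))
        \<longrightarrow> \<rho> F \<le> \<rho> G)"

definition o_superadditive :: "'a measure \<Rightarrow> (real measure \<Rightarrow> real) \<Rightarrow> bool" where
  "o_superadditive M \<rho> \<longleftrightarrow>
     (\<forall>X\<in>compact_rvs M. \<forall>Y\<in>compact_rvs M.
        \<rho> (distr M borel (\<lambda>\<omega>. X \<omega> + Y \<omega>)) \<ge> \<rho> (distr M borel X) + \<rho> (distr M borel Y))"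

definition o_concave :: "'a measure \<Rightarrow> (real measure \<Rightarrow> real) \<Rightarrow> bool" where
  "o_concave M \<rho> \<longleftrightarrow>
     (\<forall>X\<in>compact_rvs M. \<forall>Y\<in>compact_rvs M. \<forall>\<alpha>\<in>{0..1}.
        \<rho> (distr M borel (\<lambda>\<omega>. \<alpha> * X \<omega> + (1 - \<alpha>) * Y \<omega>))
          \<ge> \<alpha> * \<rho> (distr M borel X) + (1 - \<alpha>) * \<rho> (distr M borel Y))"

definition o_quasi_concave :: "'a measure \<Rightarrow> (real measure \<Rightarrow> real) \<Rightarrow> bool" where
  "o_quasi_concave M \<rho> \<longleftrightarrow>
     (\<forall>X\<in>compact_rvs M. \<forall>Y\<in>compact_rvs M. \<forall>\<alpha>\<in>{0..1}.
        \<rho> (distr M borel (\<lambda>\<omega>. \<alpha> * X \<omega> + (1 - \<alpha>) * Y \<omega>))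
          \<ge> min (\<rho> (distr M borel X)) (\<rho> (distr M borel Y)))"

definition p_convex :: "(real measure \<Rightarrow> real) \<Rightarrow> bool" where
  "p_convex \<rho> \<longleftrightarrow>
     (\<forall>F\<in>compact_distributions. \<forall>G\<in>compact_distributions. \<forall>\<alpha>\<in>{0..1}.
        \<rho> (mixture \<alpha> F G) \<le> \<alpha> * \<rho> F + (1 - \<alpha>) * \<rho> G)"

definition p_quasi_convex :: "(real measure \<Rightarrow> real) \<Rightarrow> bool" where
  "p_quasi_convex \<rho> \<longleftrightarrow>
     (\<forall>F\<in>compact_distributions. \<forall>G\<in>compact_distributions. \<forall>\<alpha>\<in>{0..1}.
        \<rho> (mixture \<alpha> F G) \<le> max (\<rho> F) (\<rho> G))"

end

theory Submission
  imports Defs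
begin

text \<open>For convex h, interpolate h on the grid i/n. The interpolant is a linear function plus a nonnegative
  combination of hinges \<open>t \<mapsto> (t - p)\<^sup>+\<close>. By the Rockafellar--Uryasev formula the functional of a hinge is
  a maximum over q of \<open>(1 - p) q - E (q - X)\<^sup>+\<close>; the expression is jointly concave in (X, q) and is the
  expectation of a concave function of X, so the functional is superadditive, concave and monotone in the
  concave order. Dominated convergence transfers this to h, and p-convexity holds pointwise under the integral.

  Conversely, a bounded midpoint convex function on a closed interval is convex. In a nonatomic space there are events
  A, B of probability (s + t)/2 with \<open>P (A \<inter> B) = s\<close> and \<open>P (A \<union> B) = t\<close>; comparing the indicators of A and B
  with their average gives the midpoint inequality from (ii), (iii) or (v). For (vii), a distribution whose
  survival function is a block at level s or t is completed by a fine staircase, shifted by one step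
  between the two distributions so that both have the same value of the functional. The staircase contributes
  nothing to the convexity defect in the limit, which leaves the midpoint inequality for s, t. This needs
  two points outside (s, t) where h is continuous with different values, and here continuity
  or strict monotonicity of h enters.\<close>

section \<open>Midpoint convexity and piecewise linear interpolation\<close>

text \<open>After subtraction of the chord over \<open>{x..y}\<close>, \<open>g\<close> is midpoint
  convex and zero at both ends. Every \<open>z\<close> is the midpoint of the nearer end and another
  point of the interval, so \<open>g z\<close> is at most half the supremum \<open>S\<close> of
  \<open>g\<close>. The bound on \<open>h\<close> makes \<open>S\<close> finite, and
  \<open>S <= S / 2\<close> forces \<open>S <= 0\<close>.\<close>

lemma midpoint_convex_imp_convex_on:
  fixes h :: "real \<Rightarrow> real"
  assumes mid: "\<And>s t. a \<le> s \<Longrightarrow> s \<le> t \<Longrightarrow> t \<le> b \<Longrightarrow> h ((s + t) / 2) \<le> (h s + h t) / 2"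
    and bdd: "\<And>x. x \<in> {a..b} \<Longrightarrow> h x \<le> B"
  shows "convex_on {a..b} h"
proof (rule convex_on_linorderI)
  fix l x y :: real
  assume l: "0 < l" "l < 1" and xy: "x \<in> {a..b}" "y \<in> {a..b}" "x < y"
  define c where "c = (h y - h x) / (y - x)"
  define g where "g z = h z - (h x + c * (z - x))" for z
  have gx: "g x = 0" and gy: "g y = 0"
    using xy by (auto simp: g_def c_def)
  have gmid: "g ((u + v) / 2) \<le> (g u + g v) / 2" if "u \<in> {x..y}" "v \<in> {x..y}" for u v
  proof -
    have "h ((u + v) / 2) \<le> (h u + h v) / 2"
      using mid[of u v] mid[of v u] that xy by (cases "u \<le> v") (auto simp: add.commute)
    moreover have "h x + c * ((u + v) / 2 - x) = ((h x + c * (u - x)) + (h x + c * (v - x))) / 2"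
      by (simp add: field_simps)
    ultimately show ?thesis by (simp add: g_def field_simps)
  qed
  have "g z \<le> B + \<bar>h x\<bar> + \<bar>c\<bar> * (y - x)" if "z \<in> {x..y}" for z
  proof -
    have "\<bar>c * (z - x)\<bar> \<le> \<bar>c\<bar> * (y - x)"
      using that by (auto simp: abs_mult intro!: mult_left_mono)
    moreover have "h z \<le> B" using that xy by (intro bdd) auto
    ultimately show ?thesis unfolding g_def by linarith
  qed
  then have bd: "bdd_above (g ` {x..y})" by (intro bdd_aboveI2) auto
  define S where "S = (SUP z\<in>{x..y}. g z)"
  have gS: "g z \<le> S" if "z \<in> {x..y}" for z
    unfolding S_def using that bd by (rule cSUP_upper)
  have half: "g z \<le> S / 2" if z: "z \<in> {x..y}" for z
  proof (cases "z \<le> (x + y) / 2")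
    case True
    then have "g ((x + (2 * z - x)) / 2) \<le> (g x + g (2 * z - x)) / 2"
      using z by (intro gmid) auto
    also have "g (2 * z - x) \<le> S" using z True by (intro gS) auto
    finally show ?thesis by (simp add: gx)
  next
    case False
    then have "g ((y + (2 * z - y)) / 2) \<le> (g y + g (2 * z - y)) / 2"
      using z by (intro gmid) auto
    also have "g (2 * z - y) \<le> S" using z False by (intro gS) auto
    finally show ?thesis by (simp add: gy)
  qed
  have "S \<le> S / 2" unfolding S_def using xy half by (intro cSUP_least) (auto simp: S_def)
  then have "S \<le> 0" by simp
  define z where "z = (1 - l) * x + l * y"
  have zx: "z - x = l * (y - x)" by (simp add: z_def algebra_simps)
  have "0 \<le> l * (y - x)" "l * (y - x) \<le> 1 * (y - x)"
    using l xy by (auto intro!: mult_right_mono)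
  then have "z \<in> {x..y}" using zx by auto
  then have "g z \<le> 0" using gS \<open>S \<le> 0\<close> by fastforce
  moreover have "c * (z - x) = l * (h y - h x)"
    using xy by (simp add: zx c_def)
  then have "h x + c * (z - x) = (1 - l) * h x + l * h y" by (simp add: algebra_simps)
  ultimately have "h z \<le> (1 - l) * h x + l * h y" by (simp add: g_def)
  then show "h ((1 - l) *\<^sub>R x + l *\<^sub>R y) \<le> (1 - l) * h x + l * h y" by (simp add: z_def)
qed simp

text \<open>Subtract the chord over a pair that violates the midpoint inequality and let
  \<open>x0\<close> be the leftmost maximum point of the difference \<open>g\<close>. Then
  \<open>g\<close> is strictly smaller to the left of \<open>x0\<close> and not larger to the right,
  so the inequality fails around \<open>x0\<close> at every small scale \<open>e\<close>, which
  later permits letting \<open>e\<close> tend to 0.\<close>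

lemma continuous_not_convex_midpoint:
  fixes h :: "real \<Rightarrow> real"
  assumes cont: "continuous_on {a..b} h" and nc: "\<not> convex_on {a..b} h"
  obtains x0 d where "0 < d" "a \<le> x0 - d" "x0 + d \<le> b"
    "\<And>e. 0 < e \<Longrightarrow> e \<le> d \<Longrightarrow> (h (x0 - e) + h (x0 + e)) / 2 < h x0"
proof -
  have "\<exists>B. \<forall>x\<in>{a..b}. h x \<le> B"
  proof (cases "a \<le> b")
    case True
    then show ?thesis using continuous_attains_sup[of "{a..b}" h] cont by auto
  qed auto
  then obtain B where B: "\<And>x. x \<in> {a..b} \<Longrightarrow> h x \<le> B" by blast
  from nc obtain s t where st: "a \<le> s" "s \<le> t" "t \<le> b" "(h s + h t) / 2 < h ((s + t) / 2)"
    using midpoint_convex_imp_convex_on[of a b h B] B by (meson not_less)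
  then have "s < t" by (cases "s = t") auto
  define c where "c = (h t - h s) / (t - s)"
  define g where "g z = h z - (h s + c * (z - s))" for z
  have gs: "g s = 0" and gt: "g t = 0"
    using \<open>s < t\<close> by (auto simp: g_def c_def)
  have gm: "g ((s + t) / 2) > 0"
  proof -
    have "c * ((s + t) / 2 - s) = (h t - h s) / 2"
      using \<open>s < t\<close> by (simp add: c_def field_simps)
    then show ?thesis using st by (simp add: g_def field_simps)
  qed
  have cg: "continuous_on {s..t} g"
    unfolding g_def using st by (intro continuous_intros continuous_on_subset[OF cont]) auto
  obtain xm where xm: "xm \<in> {s..t}" "\<And>z. z \<in> {s..t} \<Longrightarrow> g z \<le> g xm"
    using continuous_attains_sup[of "{s..t}" g] cg \<open>s < t\<close> by auto
  define K where "K = {s..t} \<inter> g -` {g xm}"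
  have "closed K" unfolding K_def by (intro continuous_closed_preimage cg) auto
  then have "compact ({s..t} \<inter> K)" by (intro compact_Int_closed compact_Icc)
  also have "{s..t} \<inter> K = K" by (auto simp: K_def)
  finally have "compact K" .
  moreover have "K \<noteq> {}" using xm by (auto simp: K_def)
  ultimately obtain x0 where x0: "x0 \<in> K" "\<And>z. z \<in> K \<Longrightarrow> x0 \<le> z"
    using compact_attains_inf[of K] by auto
  have gx0: "g x0 = g xm" "g x0 > 0" using x0 gm xm(2)[of "(s + t) / 2"] \<open>s < t\<close> by (auto simp: K_def)
  then have "x0 \<noteq> s" "x0 \<noteq> t" using gs gt by auto
  moreover have "x0 \<in> {s..t}" using x0 by (simp add: K_def)
  ultimately have x0st: "s < x0" "x0 < t" by auto
  define d where "d = min (x0 - s) (t - x0)"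
  show ?thesis
  proof (rule that[of d x0])
    show "0 < d" "a \<le> x0 - d" "x0 + d \<le> b" using x0st st by (auto simp: d_def)
  next
    fix e assume e: "0 < e" "e \<le> d"
    then have m: "x0 - e \<in> {s..t}" "x0 + e \<in> {s..t}" using x0st by (auto simp: d_def)
    have "g (x0 - e) \<noteq> g xm" using x0(2)[of "x0 - e"] m e by (auto simp: K_def)
    then have "g (x0 - e) < g x0" using xm(2) m gx0 by force
    moreover have "g (x0 + e) \<le> g x0" using xm(2) m gx0 by simp
    ultimately have "g (x0 - e) + g (x0 + e) < 2 * g x0" by simp
    then show "(h (x0 - e) + h (x0 + e)) / 2 < h x0" by (simp add: g_def algebra_simps)
  qed
qed

section \<open>Piecewise linear interpolation as a combination of hinges\<close>

definition grid_slope :: "(real \<Rightarrow> real) \<Rightarrow> nat \<Rightarrow> nat \<Rightarrow> real" where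
  "grid_slope h n i = real n * (h (real (Suc i) / real n) - h (real i / real n))"

text \<open>The interpolation of \<open>h\<close> at the points \<open>i/n\<close> is written
  through hinges: the slope jumps at the inner grid points are the coefficients. There is no
  constant term because \<open>h 0 = 0\<close> in all uses.\<close>

definition interpolant :: "(real \<Rightarrow> real) \<Rightarrow> nat \<Rightarrow> real \<Rightarrow> real" where
  "interpolant h n t = grid_slope h n 0 * t +
     (\<Sum>i\<in>{1..<n}. (grid_slope h n i - grid_slope h n (i - 1)) * max 0 (t - real i / real n))"

text \<open>On the cell number \<open>j\<close> only the hinges with \<open>i <= j\<close> are
  active, and adding up their slope jumps turns the first chord into chord number
  \<open>j\<close>.\<close>

lemma interpolant_eq_chord:
  assumes "h 0 = 0" "j < n" "t \<in> {real j / real n..real (Suc j) / real n}"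
  shows "interpolant h n t = h (real j / real n) + grid_slope h n j * (t - real j / real n)"
proof -
  let ?d = "grid_slope h n"
  have "(\<Sum>i\<in>{1..<n}. (?d i - ?d (i - 1)) * max 0 (t - real i / real n))
      = (\<Sum>i\<in>{1..j}. (?d i - ?d (i - 1)) * (t - real i / real n))"
  proof (rule sum.mono_neutral_cong_right)
    show "\<forall>i\<in>{1..<n} - {1..j}. (?d i - ?d (i - 1)) * max 0 (t - real i / real n) = 0"
    proof
      fix i assume "i \<in> {1..<n} - {1..j}"
      then have "real (Suc j) / real n \<le> real i / real n" by (intro divide_right_mono) auto
      then show "(?d i - ?d (i - 1)) * max 0 (t - real i / real n) = 0" using assms by auto
    qed
  next
    fix i assume "i \<in> {1..j}"
    then have "real i / real n \<le> real j / real n" by (intro divide_right_mono) auto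
    then show "(?d i - ?d (i - 1)) * max 0 (t - real i / real n) = (?d i - ?d (i - 1)) * (t - real i / real n)"
      using assms by auto
  qed (use assms in auto)
  \<comment> \<open>Here \<open>t\<close> is fixed and unrelated to the cell \<open>k\<close>:
    without the positive parts this is an identity of affine functions, so it can be proved by
    induction on \<open>k\<close>.\<close>
  moreover have "?d 0 * t + (\<Sum>i\<in>{1..k}. (?d i - ?d (i - 1)) * (t - real i / real n))
      = h (real k / real n) + ?d k * (t - real k / real n)" if "n > 0" for k
  proof (induction k)
    case 0
    then show ?case using assms by simp
  next
    case (Suc k)
    have "h (real (Suc k) / real n) = h (real k / real n) + ?d k / real n"
      using that by (simp add: grid_slope_def)
    moreover have "real (Suc k) / real n = real k / real n + 1 / real n" by (simp add: add_divide_distrib)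
    moreover have "(\<Sum>i\<in>{1..Suc k}. (?d i - ?d (i - 1)) * (t - real i / real n))
        = (\<Sum>i\<in>{1..k}. (?d i - ?d (i - 1)) * (t - real i / real n)) + (?d (Suc k) - ?d k) * (t - real (Suc k) / real n)"
      by simp
    ultimately show ?case using Suc.IH
      by (simp only: distrib_left distrib_right right_diff_distrib left_diff_distrib) simp
  qed
  ultimately show ?thesis using assms by (simp add: interpolant_def)
qed

lemma interpolant_between:
  assumes h0: "h 0 = 0" and n: "n > 0" and t: "t \<in> {0..1}"
  obtains j l where "j < n" "t \<in> {real j / real n..real (Suc j) / real n}" "l \<in> {0..1}"
    "interpolant h n t = (1 - l) * h (real j / real n) + l * h (real (Suc j) / real n)"
proof -
  \<comment> \<open>The floor would give \<open>j = n\<close> at \<open>t = 1\<close>, which is no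
    cell; the right end is assigned to the last cell.\<close>
  define j where "j = (if t = 1 then n - 1 else nat \<lfloor>real n * t\<rfloor>)"
  have jn: "j < n"
  proof (cases "t = 1")
    case False
    then have "real n * t < real n * 1" using t n by (intro mult_strict_left_mono) auto
    then show ?thesis using False t n by (auto simp: j_def nat_less_iff floor_less_iff)
  qed (use n in \<open>simp add: j_def\<close>)
  have jt: "real j \<le> real n * t" "real n * t \<le> real (Suc j)"
  proof -
    have "0 \<le> real n * t" using t by simp
    then have "t \<noteq> 1 \<Longrightarrow> real j \<le> real n * t \<and> real n * t \<le> real (Suc j)"
      unfolding j_def by simp linarith
    moreover have "t = 1 \<Longrightarrow> real j \<le> real n * t \<and> real n * t \<le> real (Suc j)"
      using n by (auto simp: j_def)
    ultimately show "real j \<le> real n * t" "real n * t \<le> real (Suc j)" by blast+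
  qed
  have tj: "t \<in> {real j / real n..real (Suc j) / real n}"
    using jt n by (simp add: field_simps)
  define l where "l = real n * t - real j"
  show ?thesis
  proof (rule that[OF jn tj])
    show "l \<in> {0..1}" using jt by (auto simp: l_def)
    have "t - real j / real n = l / real n" using n by (simp add: l_def field_simps)
    then show "interpolant h n t = (1 - l) * h (real j / real n) + l * h (real (Suc j) / real n)"
      using interpolant_eq_chord[of h j n t] h0 jn tj n by (simp add: grid_slope_def algebra_simps)
  qed
qed

lemma abs_interpolant_le:
  assumes "h 0 = 0" "n > 0" "t \<in> {0..1}" "\<And>x. x \<in> {0..1} \<Longrightarrow> \<bar>h x\<bar> \<le> B"
  shows "\<bar>interpolant h n t\<bar> \<le> B"
proof -
  obtain j l where j: "j < n" and l: "l \<in> {0..1}" and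
    eq: "interpolant h n t = (1 - l) * h (real j / real n) + l * h (real (Suc j) / real n)"
    using interpolant_between assms(1-3) by metis
  have "\<bar>h (real j / real n)\<bar> \<le> B" "\<bar>h (real (Suc j) / real n)\<bar> \<le> B"
    using j by (auto intro!: assms(4))
  then have "\<bar>1 - l\<bar> * \<bar>h (real j / real n)\<bar> + \<bar>l\<bar> * \<bar>h (real (Suc j) / real n)\<bar> \<le> (1 - l) * B + l * B"
    using l by (intro add_mono mult_mono) auto
  then show ?thesis
    unfolding eq using abs_triangle_ineq[of "(1 - l) * h (real j / real n)" "l * h (real (Suc j) / real n)"]
    unfolding abs_mult by (simp add: left_diff_distrib)
qed

text \<open>A convex function may jump at 0 and 1, but these are grid points of every interpolant.\<close>

lemma interpolant_tendsto:
  assumes h0: "h 0 = 0" and conv: "convex_on {0..1} h" and t: "t \<in> {0..1}"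
  shows "(\<lambda>n. interpolant h n t) \<longlonglongrightarrow> h t"
proof -
  consider "t = 0" | "t = 1" | "t \<in> {0<..<1}" using t by fastforce
  then show ?thesis
  proof cases
    case 1
    have "interpolant h n t = h t" if "n > 0" for n
      using interpolant_eq_chord[of h 0 n t] h0 that 1 by simp
    then show ?thesis by (intro tendsto_eventually eventually_sequentiallyI[of 1]) auto
  next
    case 2
    have "interpolant h n t = h t" if "n > 0" for n
    proof -
      have r: "real (n - 1) = real n - 1" using that by simp
      show ?thesis using interpolant_eq_chord[of h "n - 1" n t] h0 that 2
        by (simp add: grid_slope_def r field_simps)
    qed
    then show ?thesis by (intro tendsto_eventually eventually_sequentiallyI[of 1]) auto
  next
    case 3
    have "continuous_on {0<..<1} h"
      by (rule convex_on_continuous) (auto intro: convex_on_subset[OF conv])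
    then have cont: "isCont h t" using 3 by (simp add: continuous_on_eq_continuous_at)
    show ?thesis
    proof (rule LIMSEQ_I)
      fix r :: real assume r: "r > 0"
      obtain d where d: "d > 0" "\<And>x. \<bar>x - t\<bar> < d \<Longrightarrow> \<bar>h x - h t\<bar> < r"
        using cont[unfolded continuous_at_eps_delta] r by (auto simp: dist_real_def)
      \<comment> \<open>The cells become shorter than \<open>d\<close>, so both grid neighbours of
        \<open>t\<close> lie in the continuity neighbourhood, and so does any convex combination of
        their values in the target neighbourhood.\<close>
      obtain N :: nat where N: "1 / d < real N" using reals_Archimedean2 by blast
      have "norm (interpolant h n t - h t) < r" if n: "n \<ge> N" for n
      proof -
        have n0: "n > 0" using N n d by (cases n) (auto simp: field_simps)
        have "1 / d < real n" using N n by linarith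
        then have nd: "1 / real n < d" using d n0 by (simp add: field_simps)
        obtain j l where j: "t \<in> {real j / real n..real (Suc j) / real n}" and l: "l \<in> {0..1}" and
          eq: "interpolant h n t = (1 - l) * h (real j / real n) + l * h (real (Suc j) / real n)"
          using interpolant_between[of h n t] h0 n0 t by metis
        have "real (Suc j) / real n = real j / real n + 1 / real n" by (simp add: add_divide_distrib)
        then have "\<bar>h (real j / real n) - h t\<bar> < r" "\<bar>h (real (Suc j) / real n) - h t\<bar> < r"
          using j nd by (auto intro!: d(2))
        then have "(1 - l) * \<bar>h (real j / real n) - h t\<bar> + l * \<bar>h (real (Suc j) / real n) - h t\<bar> < r"
          using l by (intro convex_bound_lt) auto
        moreover have "interpolant h n t - h t
            = (1 - l) * (h (real j / real n) - h t) + l * (h (real (Suc j) / real n) - h t)"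
          by (simp add: eq algebra_simps)
        ultimately show ?thesis
          using l abs_triangle_ineq[of "(1 - l) * (h (real j / real n) - h t)" "l * (h (real (Suc j) / real n) - h t)"]
          by (simp add: abs_mult)
      qed
      then show "\<exists>no. \<forall>n\<ge>no. norm (interpolant h n t - h t) < r" by blast
    qed
  qed
qed

text \<open>The point \<open>i/n\<close> is the midpoint of its two grid neighbours. The lemma makes
  all hinge coefficients of the interpolant nonnegative.\<close>

lemma grid_slope_mono:
  assumes conv: "convex_on {0..1} h" and i: "1 \<le> i" "i < n"
  shows "grid_slope h n (i - 1) \<le> grid_slope h n i"
proof -
  define x y where "x = real (i - 1) / real n" and "y = real (Suc i) / real n"
  have "real i / real n = (1 - 1/2) * x + 1/2 * y"
    using i by (simp add: x_def y_def of_nat_diff field_simps)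
  moreover have "h ((1 - 1/2) *\<^sub>R x + (1/2) *\<^sub>R y) \<le> (1 - 1/2) * h x + 1/2 * h y"
    using i by (intro convex_onD[OF conv]) (auto simp: x_def y_def)
  ultimately have "2 * h (real i / real n) \<le> h x + h y" by simp
  then have "h (real i / real n) - h x \<le> h y - h (real i / real n)" by simp
  then have "real n * (h (real i / real n) - h x) \<le> real n * (h y - h (real i / real n))"
    by (intro mult_left_mono) auto
  then show ?thesis using i by (simp add: grid_slope_def x_def y_def)
qed

section \<open>Distortion riskmetrics of convex functions\<close>

lemma compact_distributionsD: "F \<in> compact_distributions \<Longrightarrow> real_distribution F"
  by (simp add: compact_distributions_def)

text \<open>The conclusion covers all larger bounds, so that a maximum of bounds serves several
  distributions at once.\<close>

lemma compact_distributions_bounded: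
  assumes "F \<in> compact_distributions"
  obtains L where "0 < L" "\<And>L'. L \<le> L' \<Longrightarrow> measure F {-L'..L'} = 1"
proof -
  interpret real_distribution F using assms by (rule compact_distributionsD)
  obtain K where K: "compact K" "prob K = 1"
    using assms by (auto simp: compact_distributions_def)
  then obtain L where L: "L > 0" "\<And>x. x \<in> K \<Longrightarrow> \<bar>x\<bar> \<le> L"
    using bounded_pos[of K] compact_imp_bounded by auto
  show ?thesis
  proof (rule that[OF L(1)])
    fix L' assume "L \<le> L'"
    then have "K \<subseteq> {-L'..L'}" using L(2) by fastforce
    then have "prob K \<le> prob {-L'..L'}" by (intro finite_measure_mono) auto
    then show "prob {-L'..L'} = 1" using K prob_le_1[of "{-L'..L'}"] by simp
  qed
qed

lemma set_integrable_Icc_bounded: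
  fixes k :: "real \<Rightarrow> real"
  assumes [measurable]: "k \<in> borel_measurable borel" and B: "\<And>x. \<bar>k x\<bar> \<le> B"
  shows "set_integrable lborel {a..b} k"
  unfolding set_integrable_def
proof (rule Bochner_Integration.integrable_bound[of lborel "\<lambda>x. B * indicator {a..b} x"])
  show "integrable lborel (\<lambda>x. B * indicator {a..b} x)"
    by (cases "a \<le> b") (auto intro!: integrable_real_indicator integrable_mult_right)
  show "AE x in lborel. norm (indicator {a..b} x *\<^sub>R k x) \<le> norm (B * indicator {a..b} x)"
    using B by (intro AE_I2) (auto simp: indicator_def intro: order_trans[OF _ abs_ge_self])
qed simp

lemma set_integral_Icc_const:
  assumes "a \<le> b"
  shows "set_integrable lborel {a..b} (\<lambda>x. c :: real)" "(LBINT x:{a..b}. c) = c * (b - a)"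
  using assms by (auto simp: set_integrable_def set_lebesgue_integral_def)

section \<open>Integrals of the survival function of a bounded distribution\<close>

context real_distribution
begin

lemma survival_eq_cdf: "prob {x<..} = 1 - prob {..x}"
  using prob_compl[of "{..x}"] by (simp add: Compl_eq_Diff_UNIV[symmetric] not_le Compl_atMost)

lemma survival_in_Icc [simp]: "prob {x<..} \<in> {0..1}"
  by simp

lemma cdf_measurable [measurable]: "(\<lambda>x. prob {..x}) \<in> borel_measurable borel"
  by (intro borel_measurable_mono monoI finite_measure_mono) auto

lemma survival_measurable [measurable]: "(\<lambda>x. prob {x<..}) \<in> borel_measurable borel"
  by (simp add: survival_eq_cdf)

lemma survival_below:
  assumes "prob {-L..L} = 1" "x < -L"
  shows "prob {x<..} = 1"
proof -
  have "prob {-L..L} \<le> prob {x<..}" using assms by (intro finite_measure_mono) auto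
  then show ?thesis using assms prob_le_1[of "{x<..}"] by simp
qed

lemma survival_above:
  assumes "prob {-L..L} = 1" "L \<le> x"
  shows "prob {x<..} = 0"
proof -
  have "prob {-L..L} \<le> prob {..x}" using assms by (intro finite_measure_mono) auto
  then show ?thesis using assms prob_le_1[of "{..x}"] by (simp add: survival_eq_cdf)
qed

lemma AE_bounded: "prob {-L..L} = 1 \<Longrightarrow> AE x in M. \<bar>x\<bar> \<le> L"
  using AE_prob_1[of "{-L..L}"] by (rule eventually_mono) auto

text \<open>From \<open>L\<close> on the survival function is 0 and \<open>h 0 = 0\<close>; below
  \<open>-L\<close> it is 1, so the second integrand vanishes there. What remains is one integral
  over \<open>{-L..L}\<close>, and the constant \<open>h 1\<close> on \<open>{-L..0}\<close>
  contributes \<open>L * h 1\<close>.\<close>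

lemma distortion_riskmetric_cut:
  assumes L: "0 \<le> L" "prob {-L..L} = 1" and h0: "h 0 = 0"
    and [measurable]: "(\<lambda>x. h (prob {x<..})) \<in> borel_measurable borel"
    and B: "\<And>x. x \<in> {0..1} \<Longrightarrow> \<bar>h x\<bar> \<le> B"
  shows "distortion_riskmetric h M = (LBINT x:{-L..L}. h (prob {x<..})) - L * h 1"
proof -
  define k where "k x = h (prob {x<..})" for x
  have [measurable]: "k \<in> borel_measurable borel" by (simp add: k_def[abs_def])
  have kB: "\<bar>k x\<bar> \<le> B" for x unfolding k_def by (intro B) simp
  have int: "set_integrable lborel {a..b} k" for a b
    by (rule set_integrable_Icc_bounded) (auto intro: kB)
  have "(LBINT x:{0..}. k x) = (LBINT x:{0..L}. k x)"
    unfolding set_lebesgue_integral_def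
    using survival_above[OF L(2)] h0
    by (intro Bochner_Integration.integral_cong) (auto simp: indicator_def k_def)
  moreover have "(LBINT x:{..0}. k x - h 1) = (LBINT x:{-L..0}. k x - h 1)"
    unfolding set_lebesgue_integral_def
    using survival_below[OF L(2)]
    by (intro Bochner_Integration.integral_cong) (auto simp: indicator_def k_def not_le)
  moreover have "(LBINT x:{-L..0}. k x - h 1) = (LBINT x:{-L..0}. k x) - L * h 1"
    using L by (subst set_integral_diff(2)[OF int]) (auto simp: set_integral_Icc_const)
  moreover have "(LBINT x:{-L..0} \<union> {0..L}. k x) = (LBINT x:{-L..0}. k x) + (LBINT x:{0..L}. k x)"
    by (intro set_integral_Un_AE int) (auto intro: AE_mp[OF AE_lborel_singleton[of 0]])
  moreover have "{-L..0} \<union> {0..L} = {-L..L}" using L by auto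
  ultimately show ?thesis by (simp add: distortion_riskmetric_def k_def)
qed

lemma integrable_bounded_support:
  assumes "prob {-L..L} = 1" and [measurable]: "f \<in> borel_measurable borel"
    and "\<And>x. \<bar>x\<bar> \<le> L \<Longrightarrow> \<bar>f x\<bar> \<le> (C :: real)"
  shows "integrable M f"
  using AE_bounded[OF assms(1)] assms(3)
  by (intro integrable_const_bound[where B = C]) (auto elim!: eventually_mono)

text \<open>For \<open>x\<close> in \<open>{-L..L}\<close> the positive part of \<open>q - x\<close>
  is the length of the set of \<open>y\<close> in \<open>{-L..q}\<close> with \<open>x <= y\<close>;
  Fubini then exchanges the two integrals.\<close>

lemma expectation_hinge:
  assumes L: "prob {-L..L} = 1" and q: "q \<in> {-L..L}"
  shows "expectation (\<lambda>x. max 0 (q - x)) = (LBINT y:{-L..q}. prob {..y})"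
proof -
  interpret P: pair_sigma_finite M lborel ..
  have "(\<integral>\<^sup>+ x. ennreal (max 0 (q - x)) \<partial>M)
      = (\<integral>\<^sup>+ x. (\<integral>\<^sup>+ y. indicator {-L..q} y * (if x \<le> y then 1 else 0) \<partial>lborel) \<partial>M)"
  proof (rule nn_integral_cong_AE, rule eventually_mono[OF AE_bounded[OF L]])
    fix x assume x: "\<bar>x\<bar> \<le> L"
    have "(\<integral>\<^sup>+ y. indicator {-L..q} y * (if x \<le> y then 1 else 0) \<partial>lborel) = (\<integral>\<^sup>+ y. indicator {x..q} y \<partial>lborel)"
      using x by (intro nn_integral_cong) (auto simp: indicator_def)
    then show "ennreal (max 0 (q - x)) = (\<integral>\<^sup>+ y. indicator {-L..q} y * (if x \<le> y then 1 else 0) \<partial>lborel)"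
      by (cases "x \<le> q") (auto simp: max_def)
  qed
  also have "\<dots> = (\<integral>\<^sup>+ y. (\<integral>\<^sup>+ x. indicator {-L..q} y * (if x \<le> y then 1 else 0) \<partial>M) \<partial>lborel)"
    by (rule P.Fubini'[symmetric]) simp
  also have "\<dots> = (\<integral>\<^sup>+ y. ennreal (indicator {-L..q} y * prob {..y}) \<partial>lborel)"
  proof (rule nn_integral_cong)
    fix y
    have "(\<integral>\<^sup>+ x. indicator {-L..q} y * (if x \<le> y then 1 else 0) \<partial>M) = indicator {-L..q} y * (\<integral>\<^sup>+ x. indicator {..y} x \<partial>M)"
      by (subst nn_integral_cmult[symmetric]) (auto intro!: nn_integral_cong simp: indicator_def)
    then show "(\<integral>\<^sup>+ x. indicator {-L..q} y * (if x \<le> y then 1 else 0) \<partial>M) = ennreal (indicator {-L..q} y * prob {..y})"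
      by (cases "y \<in> {-L..q}") (simp_all add: emeasure_eq_measure)
  qed
  finally have "(\<integral>\<^sup>+ x. ennreal (max 0 (q - x)) \<partial>M) = (\<integral>\<^sup>+ y. ennreal (indicator {-L..q} y * prob {..y}) \<partial>lborel)" .
  then show ?thesis
    unfolding set_lebesgue_integral_def by (subst (1 2) integral_eq_nn_integral) auto
qed

lemma distortion_riskmetric_hinge_cut:
  assumes L: "0 \<le> L" "prob {-L..L} = 1" and p: "0 \<le> p" "p \<le> 1"
  shows "distortion_riskmetric (\<lambda>t. max 0 (t - p)) M
    = (LBINT x:{-L..L}. max 0 (prob {x<..} - p)) - L * (1 - p)"
  using p by (subst distortion_riskmetric_cut[OF L, where B = 1]) auto

text \<open>This serves two purposes: at a quantile \<open>q\<close> it evaluates the functional of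
  a hinge, and at \<open>q = L\<close>, \<open>p = 0\<close> it yields the mean.\<close>

lemma survival_integral:
  assumes L: "prob {-L..L} = 1" and q: "q \<in> {-L..L}"
  shows "(LBINT x:{-L..q}. prob {x<..} - p) = (1 - p) * (q + L) - expectation (\<lambda>x. max 0 (q - x))"
proof -
  have int: "set_integrable lborel {-L..q} (\<lambda>x. prob {..x})"
    by (rule set_integrable_Icc_bounded[where B = 1]) auto
  have "(LBINT x:{-L..q}. prob {x<..} - p) = (LBINT x:{-L..q}. (1 - p) - prob {..x})"
    by (simp add: survival_eq_cdf algebra_simps)
  also have "\<dots> = (1 - p) * (q + L) - (LBINT x:{-L..q}. prob {..x})"
    using q by (subst set_integral_diff(2)[OF _ int]) (auto simp: set_integral_Icc_const algebra_simps)
  finally show ?thesis using expectation_hinge[OF L q] by simp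
qed

text \<open>The Rockafellar--Uryasev formula: the functional of a hinge is a maximum over q of the expectations
  of the concave functions \<open>x \<mapsto> (1 - p) q - (q - x)\<^sup>+\<close>.\<close>

lemma distortion_riskmetric_hinge_ge:
  assumes L: "0 \<le> L" "prob {-L..L} = 1" and p: "0 \<le> p" "p \<le> 1" and q: "q \<in> {-L..L}"
  shows "(1 - p) * q - expectation (\<lambda>x. max 0 (q - x)) \<le> distortion_riskmetric (\<lambda>t. max 0 (t - p)) M"
proof -
  have B: "\<bar>prob {x<..} - p\<bar> \<le> 1" for x using p prob_le_1[of "{x<..}"] measure_nonneg[of M "{x<..}"] by linarith
  have B': "\<bar>max 0 (prob {x<..} - p)\<bar> \<le> 1" for x using B[of x] by linarith
  \<comment> \<open>The integrand on the left is at most its positive part, which is also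
    nonnegative beyond \<open>q\<close>.\<close>
  have "(LBINT x:{-L..q}. prob {x<..} - p) \<le> (LBINT x:{-L..L}. max 0 (prob {x<..} - p))"
    unfolding set_lebesgue_integral_def using q
    by (intro integral_mono set_integrable_Icc_bounded[where B = 1, unfolded set_integrable_def])
       (use B B' in \<open>auto simp: indicator_def\<close>)
  then show ?thesis
    using survival_integral[OF L(2) q, of p] distortion_riskmetric_hinge_cut[OF L p] by (simp add: algebra_simps)
qed

text \<open>The maximum is attained at a quantile: the survival function is at least
  \<open>p\<close> before \<open>q\<close> and at most \<open>p\<close> after it, so the positive
  part of its difference to \<open>p\<close> is that difference up to \<open>q\<close> and 0 beyond,
  except possibly at \<open>q\<close> itself.\<close>

lemma distortion_riskmetric_hinge_attained:
  assumes L: "0 \<le> L" "prob {-L..L} = 1" and p: "0 \<le> p" "p \<le> 1"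
  obtains q where "q \<in> {-L..L}"
    "distortion_riskmetric (\<lambda>t. max 0 (t - p)) M = (1 - p) * q - expectation (\<lambda>x. max 0 (q - x))"
proof -
  \<comment> \<open>The point \<open>-L\<close> is inserted to keep the set nonempty: with an atom
    at \<open>-L\<close> the survival function may lie below \<open>p\<close> on all of
    \<open>{-L..L}\<close>.\<close>
  define Q where "Q = insert (-L) {x. -L \<le> x \<and> x \<le> L \<and> p \<le> prob {x<..}}"
  define q where "q = Sup Q"
  have bd: "bdd_above Q" using L by (intro bdd_aboveI[of _ L]) (auto simp: Q_def)
  have q: "q \<in> {-L..L}"
    using L cSup_upper[OF _ bd, of "-L"] unfolding q_def
    by (auto intro!: cSup_least simp: Q_def)
  have ge: "p \<le> prob {x<..}" if "-L \<le> x" "x < q" for x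
  proof -
    have "Q \<noteq> {}" by (simp add: Q_def)
    moreover have "x < Sup Q" using that by (simp add: q_def)
    ultimately obtain y where y: "y \<in> Q" "x < y" using bd by (auto simp: less_cSup_iff)
    then have "p \<le> prob {y<..}" using that by (auto simp: Q_def)
    also have "\<dots> \<le> prob {x<..}" using y by (intro finite_measure_mono) auto
    finally show ?thesis .
  qed
  have le: "prob {x<..} \<le> p" if "q < x" "x \<le> L" for x
  proof (rule ccontr)
    assume "\<not> ?thesis"
    then have "x \<in> Q" using that q by (auto simp: Q_def)
    then show False using cSup_upper[OF _ bd, of x] that by (simp add: q_def)
  qed
  have "(LBINT x:{-L..L}. max 0 (prob {x<..} - p)) = (LBINT x:{-L..q}. prob {x<..} - p)"
    unfolding set_lebesgue_integral_def
  proof (rule integral_cong_AE)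
    show "AE x in lborel. indicator {-L..L} x *\<^sub>R max 0 (prob {x<..} - p) = indicator {-L..q} x *\<^sub>R (prob {x<..} - p)"
      using AE_lborel_singleton[of q]
    proof eventually_elim
      case (elim x)
      then consider "x < q" | "q < x" by linarith
      then show ?case
        using ge[of x] le[of x] q by cases (auto simp: indicator_def)
    qed
  qed auto
  then show ?thesis
    using survival_integral[OF L(2) q, of p] distortion_riskmetric_hinge_cut[OF L p] q
    by (intro that[of q]) (auto simp: algebra_simps)
qed

lemma survival_mean:
  assumes L: "0 \<le> L" "prob {-L..L} = 1"
  shows "(LBINT x:{-L..L}. prob {x<..}) - L = expectation (\<lambda>x. x)"
proof -
  have int: "integrable M (\<lambda>x. x)" by (rule integrable_bounded_support[OF L(2)]) auto
  have "expectation (\<lambda>x. max 0 (L - x)) = expectation (\<lambda>x. L - x)"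
    using AE_bounded[OF L(2)] by (intro integral_cong_AE) (auto elim!: eventually_mono)
  also have "\<dots> = L - expectation (\<lambda>x. x)"
    using int prob_space by simp
  finally show ?thesis using survival_integral[OF L(2), of L 0] L by simp
qed

text \<open>The functional is linear in the distortion function. The linear part of the interpolant
  gives the mean by \<open>survival_mean\<close>.\<close>

lemma distortion_riskmetric_interpolant:
  assumes L: "0 \<le> L" "prob {-L..L} = 1"
  shows "distortion_riskmetric (interpolant h n) M = grid_slope h n 0 * expectation (\<lambda>x. x) +
     (\<Sum>i\<in>{1..<n}. (grid_slope h n i - grid_slope h n (i - 1)) *
        distortion_riskmetric (\<lambda>t. max 0 (t - real i / real n)) M)"
proof -
  \<comment> \<open>Each hinge is at most 1 on \<open>{0..1}\<close>, so this crude bound suffices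
    for \<open>distortion_riskmetric_cut\<close>.\<close>
  define B where "B = \<bar>grid_slope h n 0\<bar> + (\<Sum>i\<in>{1..<n}. \<bar>grid_slope h n i - grid_slope h n (i - 1)\<bar>)"
  have B: "\<bar>interpolant h n t\<bar> \<le> B" if "t \<in> {0..1}" for t
  proof -
    have "\<bar>grid_slope h n 0 * t\<bar> \<le> \<bar>grid_slope h n 0\<bar> * 1"
      unfolding abs_mult using that by (intro mult_left_mono) auto
    moreover have "\<bar>\<Sum>i\<in>{1..<n}. (grid_slope h n i - grid_slope h n (i - 1)) * max 0 (t - real i / real n)\<bar>
        \<le> (\<Sum>i\<in>{1..<n}. \<bar>grid_slope h n i - grid_slope h n (i - 1)\<bar> * 1)"
    proof (intro order_trans[OF sum_abs] sum_mono)
      fix i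
      have "0 \<le> real i / real n" by simp
      then have "\<bar>max 0 (t - real i / real n)\<bar> \<le> 1" using that unfolding atLeastAtMost_iff by linarith
      then show "\<bar>(grid_slope h n i - grid_slope h n (i - 1)) * max 0 (t - real i / real n)\<bar>
          \<le> \<bar>grid_slope h n i - grid_slope h n (i - 1)\<bar> * 1"
        unfolding abs_mult by (intro mult_left_mono) auto
    qed
    ultimately show ?thesis unfolding interpolant_def B_def mult_1_right by linarith
  qed
  have i1: "set_integrable lborel {-L..L} (\<lambda>x. prob {x<..})"
    by (rule set_integrable_Icc_bounded[where B = 1]) auto
  have "\<bar>max 0 (prob {x<..} - real i / real n)\<bar> \<le> 1" for x i
  proof -
    have "0 \<le> real i / real n" by simp
    then show ?thesis using prob_le_1[of "{x<..}"] by linarith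
  qed
  then have i2: "set_integrable lborel {-L..L} (\<lambda>x. max 0 (prob {x<..} - real i / real n))" for i
    by (intro set_integrable_Icc_bounded[where B = 1]) auto
  have "(LBINT x:{-L..L}. interpolant h n (prob {x<..})) = grid_slope h n 0 * (LBINT x:{-L..L}. prob {x<..}) +
     (\<Sum>i\<in>{1..<n}. (grid_slope h n i - grid_slope h n (i - 1)) *
        (LBINT x:{-L..L}. max 0 (prob {x<..} - real i / real n)))"
  proof -
    have "indicator {-L..L} x *\<^sub>R interpolant h n (prob {x<..})
        = grid_slope h n 0 * (indicator {-L..L} x *\<^sub>R prob {x<..}) +
          (\<Sum>i\<in>{1..<n}. (grid_slope h n i - grid_slope h n (i - 1)) *
             (indicator {-L..L} x *\<^sub>R max 0 (prob {x<..} - real i / real n)))" for x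
      by (simp add: interpolant_def indicator_def)
    then show ?thesis
      using i1 i2 unfolding set_lebesgue_integral_def set_integrable_def
      by (simp only:) (simp add: Bochner_Integration.integral_sum)
  qed
  moreover have "distortion_riskmetric (interpolant h n) M
      = (LBINT x:{-L..L}. interpolant h n (prob {x<..})) - L * interpolant h n 1"
    by (rule distortion_riskmetric_cut[OF L _ _ B]) (auto simp: interpolant_def)
  moreover have "(\<Sum>i\<in>{1..<n}. (grid_slope h n i - grid_slope h n (i - 1)) *
        distortion_riskmetric (\<lambda>t. max 0 (t - real i / real n)) M) =
     (\<Sum>i\<in>{1..<n}. (grid_slope h n i - grid_slope h n (i - 1)) *
        ((LBINT x:{-L..L}. max 0 (prob {x<..} - real i / real n)) - L * max 0 (1 - real i / real n)))"
    by (intro sum.cong refl) (subst distortion_riskmetric_hinge_cut[OF L]; simp)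
  moreover have "interpolant h n 1 = grid_slope h n 0 +
     (\<Sum>i\<in>{1..<n}. (grid_slope h n i - grid_slope h n (i - 1)) * max 0 (1 - real i / real n))"
    by (simp add: interpolant_def)
  ultimately show ?thesis
    by (simp add: survival_mean[OF L, symmetric] algebra_simps sum_subtractf sum_distrib_left sum.distrib)
qed

text \<open>The values of \<open>h\<close> outside \<open>{0..1}\<close> are arbitrary, so
  measurability is derived for the composition, as a pointwise limit of measurable
  interpolants.\<close>

lemma distortion_measurable:
  assumes "h 0 = 0" "convex_on {0..1} h"
  shows "(\<lambda>x. h (prob {x<..})) \<in> borel_measurable borel"
proof (rule borel_measurable_LIMSEQ_real)
  show "(\<lambda>n. interpolant h n (prob {x<..})) \<longlonglongrightarrow> h (prob {x<..})" for x
    using assms by (rule interpolant_tendsto) simp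
qed (simp add: interpolant_def)

text \<open>The interpolants inherit the bound \<open>B\<close>, so dominated convergence applies on
  \<open>{-L..L}\<close>. The index \<open>Suc n\<close> avoids the empty grid.\<close>

lemma distortion_riskmetric_interpolant_tendsto:
  assumes L: "0 \<le> L" "prob {-L..L} = 1" and h0: "h 0 = 0" and conv: "convex_on {0..1} h"
    and B: "\<And>x. x \<in> {0..1} \<Longrightarrow> \<bar>h x\<bar> \<le> B"
  shows "(\<lambda>n. distortion_riskmetric (interpolant h (Suc n)) M) \<longlonglongrightarrow> distortion_riskmetric h M"
proof -
  have m [measurable]: "(\<lambda>x. h (prob {x<..})) \<in> borel_measurable borel"
    using h0 conv by (rule distortion_measurable)
  have lim: "(\<lambda>n. interpolant h (Suc n) t) \<longlonglongrightarrow> h t" if "t \<in> {0..1}" for t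
    using interpolant_tendsto[OF h0 conv that] by (rule LIMSEQ_Suc)
  have Bn: "\<bar>interpolant h (Suc n) t\<bar> \<le> B" if "t \<in> {0..1}" for n t
    using h0 that B by (intro abs_interpolant_le) auto
  have [measurable]: "(\<lambda>x. interpolant h (Suc n) (prob {x<..})) \<in> borel_measurable borel" for n
    by (simp add: interpolant_def)
  have "(\<lambda>n. LBINT x:{-L..L}. interpolant h (Suc n) (prob {x<..})) \<longlonglongrightarrow> (LBINT x:{-L..L}. h (prob {x<..}))"
    unfolding set_lebesgue_integral_def
  proof (rule integral_dominated_convergence[where w = "\<lambda>x. B * indicator {-L..L} x"])
    show "integrable lborel (\<lambda>x. B * indicator {-L..L} x)"
      using L by (auto intro!: integrable_real_indicator integrable_mult_right)
    show "AE x in lborel. (\<lambda>n. indicator {-L..L} x *\<^sub>R interpolant h (Suc n) (prob {x<..}))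
        \<longlonglongrightarrow> indicator {-L..L} x *\<^sub>R h (prob {x<..})"
      by (intro AE_I2 tendsto_intros lim) simp
    show "AE x in lborel. norm (indicator {-L..L} x *\<^sub>R interpolant h (Suc n) (prob {x<..})) \<le> B * indicator {-L..L} x" for n
      by (intro AE_I2) (auto simp: indicator_def intro!: Bn)
  qed auto
  then have "(\<lambda>n. (LBINT x:{-L..L}. interpolant h (Suc n) (prob {x<..})) - L * interpolant h (Suc n) 1)
      \<longlonglongrightarrow> (LBINT x:{-L..L}. h (prob {x<..})) - L * h 1"
    by (intro tendsto_intros lim) simp_all
  then show ?thesis
    using distortion_riskmetric_cut[OF L h0 m B]
    by (subst distortion_riskmetric_cut[OF L _ _ Bn]) (simp_all add: interpolant_def[of h _ 0])
qed

end

text \<open>The common source of superadditivity, concavity and concave-order monotonicity, stated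
  for distributions through means and hinge expectations only. For one hinge, maximizers
  \<open>q\<close>, \<open>q'\<close> for \<open>F\<close>, \<open>F'\<close> are combined to the
  competitor \<open>a * q + b * q'\<close> for \<open>G\<close>. Nonnegative coefficients extend
  this to interpolants, whose linear part is settled by the means, and a limit extends it to
  \<open>h\<close>.\<close>

lemma distortion_riskmetric_superadditive:
  assumes F: "F \<in> compact_distributions" "F' \<in> compact_distributions" "G \<in> compact_distributions"
    and ab: "0 \<le> a" "0 \<le> b"
    and mean: "(LINT x|G. x) = a * (LINT x|F. x) + b * (LINT x|F'. x)"
    and hinge: "\<And>q q'. (LINT x|G. max 0 (a * q + b * q' - x))
        \<le> a * (LINT x|F. max 0 (q - x)) + b * (LINT x|F'. max 0 (q' - x))"
    and h0: "h 0 = 0" and conv: "convex_on {0..1} h" and B: "\<And>x. x \<in> {0..1} \<Longrightarrow> \<bar>h x\<bar> \<le> B"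
  shows "a * distortion_riskmetric h F + b * distortion_riskmetric h F' \<le> distortion_riskmetric h G"
proof -
  interpret F: real_distribution F using F(1) by (rule compact_distributionsD)
  interpret F': real_distribution F' using F(2) by (rule compact_distributionsD)
  interpret G: real_distribution G using F(3) by (rule compact_distributionsD)
  obtain L1 where L1: "0 < L1" "\<And>L'. L1 \<le> L' \<Longrightarrow> measure F {-L'..L'} = 1"
    using compact_distributions_bounded[OF F(1)] by blast
  obtain L2 where L2: "0 < L2" "\<And>L'. L2 \<le> L' \<Longrightarrow> measure F' {-L'..L'} = 1"
    using compact_distributions_bounded[OF F(2)] by blast
  obtain L3 where L3: "0 < L3" "\<And>L'. L3 \<le> L' \<Longrightarrow> measure G {-L'..L'} = 1"
    using compact_distributions_bounded[OF F(3)] by blast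
  define L where "L = max L1 L2"
  \<comment> \<open>The lower bound for \<open>G\<close> admits only competitors inside the cut-off
    interval, so \<open>K\<close> must also cover \<open>a * q + b * q'\<close>.\<close>
  define K where "K = max L3 (a * L + b * L)"
  have L: "0 \<le> L" "measure F {-L..L} = 1" "measure F' {-L..L} = 1"
    using L1 L2 by (auto simp: L_def)
  have K: "0 \<le> K" "measure G {-K..K} = 1" using L3 by (auto simp: K_def)
  have hinge_case: "a * distortion_riskmetric (\<lambda>t. max 0 (t - p)) F + b * distortion_riskmetric (\<lambda>t. max 0 (t - p)) F'
      \<le> distortion_riskmetric (\<lambda>t. max 0 (t - p)) G" if p: "0 \<le> p" "p \<le> 1" for p
  proof -
    obtain q where q: "q \<in> {-L..L}" "distortion_riskmetric (\<lambda>t. max 0 (t - p)) F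
        = (1 - p) * q - (LINT x|F. max 0 (q - x))"
      using F.distortion_riskmetric_hinge_attained[OF L(1,2) p] by blast
    obtain q' where q': "q' \<in> {-L..L}" "distortion_riskmetric (\<lambda>t. max 0 (t - p)) F'
        = (1 - p) * q' - (LINT x|F'. max 0 (q' - x))"
      using F'.distortion_riskmetric_hinge_attained[OF L(1,3) p] by blast
    have "\<bar>a * q\<bar> \<le> a * L" "\<bar>b * q'\<bar> \<le> b * L"
      using q q' ab by (auto simp: abs_mult intro!: mult_left_mono)
    then have "a * q + b * q' \<in> {-K..K}" by (auto simp: K_def)
    from G.distortion_riskmetric_hinge_ge[OF K p this] hinge[of q q'] show ?thesis
      unfolding q(2) q'(2) by (simp add: algebra_simps)
  qed
  have "a * distortion_riskmetric (interpolant h (Suc n)) F + b * distortion_riskmetric (interpolant h (Suc n)) F'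
      \<le> distortion_riskmetric (interpolant h (Suc n)) G" for n
  proof -
    let ?c = "\<lambda>i. grid_slope h (Suc n) i - grid_slope h (Suc n) (i - 1)"
    let ?p = "\<lambda>i. \<lambda>t :: real. max 0 (t - real i / real (Suc n))"
    have "(\<Sum>i\<in>{1..<Suc n}. ?c i * (a * distortion_riskmetric (?p i) F + b * distortion_riskmetric (?p i) F'))
       \<le> (\<Sum>i\<in>{1..<Suc n}. ?c i * distortion_riskmetric (?p i) G)"
      using grid_slope_mono[OF conv] by (intro sum_mono mult_left_mono hinge_case) auto
    then show ?thesis
      unfolding F.distortion_riskmetric_interpolant[OF L(1,2)] F'.distortion_riskmetric_interpolant[OF L(1,3)]
        G.distortion_riskmetric_interpolant[OF K] mean
      by (simp only: distrib_left distrib_right sum.distrib sum_distrib_left mult.assoc mult.left_commute)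
  qed
  moreover have "(\<lambda>n. a * distortion_riskmetric (interpolant h (Suc n)) F + b * distortion_riskmetric (interpolant h (Suc n)) F')
      \<longlonglongrightarrow> a * distortion_riskmetric h F + b * distortion_riskmetric h F'"
    by (intro tendsto_intros F.distortion_riskmetric_interpolant_tendsto[OF L(1,2) h0 conv B]
        F'.distortion_riskmetric_interpolant_tendsto[OF L(1,3) h0 conv B])
  moreover have "(\<lambda>n. distortion_riskmetric (interpolant h (Suc n)) G) \<longlonglongrightarrow> distortion_riskmetric h G"
    by (rule G.distortion_riskmetric_interpolant_tendsto[OF K h0 conv B])
  ultimately show ?thesis by (intro LIMSEQ_le) auto
qed

section \<open>Mixtures of distributions\<close>

lemma measure_mixture:
  assumes "real_distribution F" "real_distribution G" "l \<in> {0..1}" and A: "A \<in> sets borel"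
  shows "measure (mixture l F G) A = l * measure F A + (1 - l) * measure G A"
proof -
  interpret F: real_distribution F by fact
  interpret G: real_distribution G by fact
  have "emeasure (mixture l F G) A = ennreal (l * measure F A + (1 - l) * measure G A)"
    using assms by (subst emeasure_mixture)
      (simp_all add: F.emeasure_eq_measure G.emeasure_eq_measure ennreal_plus ennreal_mult)
  moreover have "0 \<le> l * measure F A + (1 - l) * measure G A" using assms by auto
  ultimately show ?thesis unfolding measure_def[of "mixture l F G"] by simp
qed

text \<open>Survival functions mix linearly, so convexity of \<open>h\<close> applies at each
  \<open>x\<close>; cutting all three distributions at one \<open>L\<close> makes the terms with
  \<open>h 1\<close> cancel.\<close>

lemma convex_imp_p_convex:
  assumes h0: "h 0 = 0" and conv: "convex_on {0..1} h" and B: "\<And>x. x \<in> {0..1} \<Longrightarrow> \<bar>h x\<bar> \<le> B"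
  shows "p_convex (distortion_riskmetric h)"
  unfolding p_convex_def
proof (intro ballI)
  fix F G and l :: real
  assume F: "F \<in> compact_distributions" and G: "G \<in> compact_distributions" and l: "l \<in> {0..1}"
  have H: "mixture l F G \<in> compact_distributions"
    using F G l by (rule mixture_in_compact_distributions)
  interpret F: real_distribution F using F by (rule compact_distributionsD)
  interpret G: real_distribution G using G by (rule compact_distributionsD)
  interpret H: real_distribution "mixture l F G" using H by (rule compact_distributionsD)
  obtain L1 where L1: "0 < L1" "\<And>L'. L1 \<le> L' \<Longrightarrow> measure F {-L'..L'} = 1"
    using compact_distributions_bounded[OF F] by blast
  obtain L2 where L2: "0 < L2" "\<And>L'. L2 \<le> L' \<Longrightarrow> measure G {-L'..L'} = 1"
    using compact_distributions_bounded[OF G] by blast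
  obtain L3 where L3: "0 < L3" "\<And>L'. L3 \<le> L' \<Longrightarrow> measure (mixture l F G) {-L'..L'} = 1"
    using compact_distributions_bounded[OF H] by blast
  define L where "L = max L1 (max L2 L3)"
  have L: "0 \<le> L" "measure F {-L..L} = 1" "measure G {-L..L} = 1" "measure (mixture l F G) {-L..L} = 1"
    using L1 L2 L3 by (auto simp: L_def)
  have mix: "measure (mixture l F G) {x<..} = l * measure F {x<..} + (1 - l) * measure G {x<..}" for x
    using l by (intro measure_mixture F.real_distribution_axioms G.real_distribution_axioms) auto
  note m [measurable] = F.distortion_measurable[OF h0 conv] G.distortion_measurable[OF h0 conv]
    H.distortion_measurable[OF h0 conv]
  have iF: "set_integrable lborel {-L..L} (\<lambda>x. h (measure F {x<..}))"
    and iG: "set_integrable lborel {-L..L} (\<lambda>x. h (measure G {x<..}))"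
    and iH: "set_integrable lborel {-L..L} (\<lambda>x. h (measure (mixture l F G) {x<..}))"
    by (intro set_integrable_Icc_bounded[where B = B] m B F.survival_in_Icc G.survival_in_Icc H.survival_in_Icc)+
  have "(LBINT x:{-L..L}. h (measure (mixture l F G) {x<..}))
      \<le> (LBINT x:{-L..L}. l * h (measure F {x<..}) + (1 - l) * h (measure G {x<..}))"
  proof (intro set_integral_mono iH set_integral_add(1) set_integrable_mult_right)
    fix x
    show "h (measure (mixture l F G) {x<..}) \<le> l * h (measure F {x<..}) + (1 - l) * h (measure G {x<..})"
      using convex_onD[OF conv, of "1 - l" "measure F {x<..}" "measure G {x<..}"] l by (simp add: mix)
  qed (use iF iG in auto)
  also have "\<dots> = l * (LBINT x:{-L..L}. h (measure F {x<..})) + (1 - l) * (LBINT x:{-L..L}. h (measure G {x<..}))"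
    by (simp add: set_integral_add iF iG)
  finally show "distortion_riskmetric h (mixture l F G)
      \<le> l * distortion_riskmetric h F + (1 - l) * distortion_riskmetric h G"
    using F.distortion_riskmetric_cut[OF L(1,2) h0 m(1) B] G.distortion_riskmetric_cut[OF L(1,3) h0 m(2) B]
      H.distortion_riskmetric_cut[OF L(1,4) h0 m(3) B]
    by (simp only:) (simp add: algebra_simps)
qed

section \<open>Random variables on a nonatomic space\<close>

context prob_space
begin

text \<open>A set of positive probability splits into two parts of positive probability, one of
  which has at most half of it; this is iterated.\<close>

lemma nonatomic_small_subset:
  assumes na: "nonatomic M" and A: "A \<in> sets M" "0 < prob A" and e: "0 < e"
  obtains B where "B \<in> sets M" "B \<subseteq> A" "0 < prob B" "prob B \<le> e"
proof -
  have "\<exists>B\<in>sets M. B \<subseteq> A \<and> 0 < prob B \<and> prob B \<le> prob A / 2 ^ n" for n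
  proof (induction n)
    case 0
    then show ?case using A by auto
  next
    case (Suc n)
    then obtain B where B: "B \<in> sets M" "B \<subseteq> A" "0 < prob B" "prob B \<le> prob A / 2 ^ n" by blast
    then obtain C where C: "C \<in> sets M" "C \<subseteq> B" "0 < prob C" "prob C < prob B"
      using na by (auto simp: nonatomic_def emeasure_eq_measure ennreal_less_iff)
    have half: "prob A / 2 ^ Suc n = prob A / 2 ^ n / 2" by simp
    have BC: "prob (B - C) = prob B - prob C" using B C by (intro finite_measure_Diff) auto
    show ?case
    proof (cases "prob C \<le> prob B / 2")
      case True
      then show ?thesis using B C by (intro bexI[of _ C]) (auto simp del: power_Suc simp: half)
    next
      case False
      then show ?thesis using B C BC by (intro bexI[of _ "B - C"]) (auto simp del: power_Suc simp: half)
    qed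
  qed
  moreover obtain n where "prob A / e < 2 ^ n"
    using real_arch_pow[of 2 "prob A / e"] by auto
  then have "prob A / 2 ^ n \<le> e" using e by (simp add: field_simps)
  ultimately show ?thesis using that by (meson order_trans)
qed

text \<open>Sierpinski's theorem, by greedy exhaustion: each step adds at least half of what can still be added.\<close>

lemma nonatomic_subset_prob:
  assumes na: "nonatomic M" and A: "A \<in> sets M" and c: "0 \<le> c" "c \<le> prob A"
  obtains B where "B \<in> sets M" "B \<subseteq> A" "prob B = c"
proof -
  define P where "P B \<longleftrightarrow> B \<in> sets M \<and> B \<subseteq> A \<and> prob B \<le> c" for B
  define Q where "Q B B' \<longleftrightarrow> B \<subseteq> B' \<and>
    (\<forall>C\<in>sets M. C \<subseteq> A - B \<longrightarrow> prob C \<le> c - prob B \<longrightarrow> prob C \<le> 2 * (prob B' - prob B))" for B B'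
  have "\<exists>B'. P B' \<and> Q B B'" if "P B" for B
  proof -
    define S where "S = (SUP C\<in>{C\<in>sets M. C \<subseteq> A - B \<and> prob C \<le> c - prob B}. prob C)"
    have bd: "bdd_above (prob ` {C\<in>sets M. C \<subseteq> A - B \<and> prob C \<le> c - prob B})"
      by (intro bdd_aboveI2[of _ _ 1]) simp
    have up: "prob C \<le> S" if "C \<in> sets M" "C \<subseteq> A - B" "prob C \<le> c - prob B" for C
      unfolding S_def using that by (intro cSUP_upper bd) auto
    \<comment> \<open>The supremum \<open>S\<close> need not be attained. If it is positive, some
      admissible set exceeds \<open>S / 2\<close>; otherwise the empty set serves.\<close>
    have ex: "\<exists>C\<in>sets M. C \<subseteq> A - B \<and> prob C \<le> c - prob B \<and> S / 2 \<le> prob C"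
    proof (cases "S \<le> 0")
      case True
      then show ?thesis using \<open>P B\<close> by (intro bexI[of _ "{}"]) (auto simp: P_def)
    next
      case False
      have "{} \<in> {C\<in>sets M. C \<subseteq> A - B \<and> prob C \<le> c - prob B}" using \<open>P B\<close> by (simp add: P_def)
      moreover have "S / 2 < S" using False by simp
      ultimately obtain C where "C \<in> {C\<in>sets M. C \<subseteq> A - B \<and> prob C \<le> c - prob B}" "S / 2 < prob C"
        using less_cSUP_iff[OF _ bd, of "S / 2"] unfolding S_def[symmetric] by blast
      then show ?thesis by (intro bexI[of _ C]) auto
    qed
    then obtain C where C: "C \<in> sets M" "C \<subseteq> A - B" "prob C \<le> c - prob B" "S / 2 \<le> prob C" by blast
    have BC: "prob (B \<union> C) = prob B + prob C"
      using C \<open>P B\<close> by (intro finite_measure_Union) (auto simp: P_def)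
    have "P (B \<union> C)" using C \<open>P B\<close> BC by (auto simp: P_def)
    moreover have "Q B (B \<union> C)"
      unfolding Q_def
    proof (intro conjI ballI impI)
      fix D assume "D \<in> sets M" "D \<subseteq> A - B" "prob D \<le> c - prob B"
      then have "prob D \<le> S" by (rule up)
      then show "prob D \<le> 2 * (prob (B \<union> C) - prob B)" using C(4) BC by simp
    qed simp
    ultimately show ?thesis by blast
  qed
  moreover have "P {}" using c by (simp add: P_def)
  ultimately obtain f where f: "\<And>n. P (f n)" "\<And>n. Q (f n) (f (Suc n))"
    using dependent_nat_choice[of "\<lambda>_. P" "\<lambda>_. Q"] by metis
  define B where "B = (\<Union>n. f n)"
  have inc: "incseq f" using f(2) by (intro incseq_SucI) (auto simp: Q_def)
  have fM: "f n \<in> sets M" "f n \<subseteq> A" "prob (f n) \<le> c" for n using f(1) by (auto simp: P_def)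
  then have B: "B \<in> sets M" "B \<subseteq> A" by (auto simp: B_def)
  have lim: "(\<lambda>n. prob (f n)) \<longlonglongrightarrow> prob B"
    unfolding B_def using inc fM by (intro finite_Lim_measure_incseq) auto
  have Bc: "prob B \<le> c" using lim fM by (intro LIMSEQ_le_const2[OF lim]) auto
  have "prob B = c"
  proof (rule ccontr)
    assume "prob B \<noteq> c"
    then have lt: "prob B < c" using Bc by simp
    have "prob (A - B) = prob A - prob B" using A B by (intro finite_measure_Diff) auto
    then have "0 < prob (A - B)" using lt c by simp
    then obtain C where C: "C \<in> sets M" "C \<subseteq> A - B" "0 < prob C" "prob C \<le> c - prob B"
      using nonatomic_small_subset[OF na, of "A - B" "c - prob B"] A B lt by auto
    \<comment> \<open>The leftover set \<open>C\<close> is admissible at every stage, so every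
      increment is at least half of \<open>prob C\<close>, whereas the increments of a convergent
      sequence tend to 0.\<close>
    have "prob C \<le> 2 * (prob (f (Suc n)) - prob (f n))" for n
    proof -
      have "prob (f n) \<le> prob B" using B by (intro finite_measure_mono) (auto simp: B_def)
      moreover have "C \<subseteq> A - f n" using C by (auto simp: B_def)
      ultimately show ?thesis using f(2)[of n] C by (auto simp: Q_def)
    qed
    moreover have "(\<lambda>n. 2 * (prob (f (Suc n)) - prob (f n))) \<longlonglongrightarrow> 2 * (prob B - prob B)"
      by (intro tendsto_intros lim LIMSEQ_Suc)
    ultimately have "prob C \<le> 2 * (prob B - prob B)" by (intro LIMSEQ_le_const) auto
    then show False using C by simp
  qed
  then show ?thesis using B that by blast
qed

text \<open>Choose nested events \<open>C\<close>, \<open>A\<close>, \<open>U\<close> of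
  probabilities \<open>s\<close>, \<open>(s + t) / 2\<close>, \<open>t\<close>; the second event
  consists of \<open>C\<close> and the part of \<open>U\<close> outside \<open>A\<close>.\<close>

lemma nonatomic_overlapping_pair:
  assumes na: "nonatomic M" and st: "0 \<le> s" "s \<le> t" "t \<le> 1"
  obtains A B where "A \<in> sets M" "B \<in> sets M" "prob A = (s + t) / 2" "prob B = (s + t) / 2"
    "prob (A \<inter> B) = s" "prob (A \<union> B) = t"
proof -
  obtain U where U: "U \<in> sets M" "prob U = t"
    using nonatomic_subset_prob[OF na sets.top, of t] st by (auto simp: prob_space)
  obtain A where A: "A \<in> sets M" "A \<subseteq> U" "prob A = (s + t) / 2"
    using nonatomic_subset_prob[OF na U(1), of "(s + t) / 2"] st U by auto
  obtain C where C: "C \<in> sets M" "C \<subseteq> A" "prob C = s"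
    using nonatomic_subset_prob[OF na A(1), of s] st A by auto
  have "prob ((U - A) \<union> C) = prob (U - A) + prob C" using U A C by (intro finite_measure_Union) auto
  also have "prob (U - A) = t - (s + t) / 2" using U A by (subst finite_measure_Diff) auto
  finally have "prob ((U - A) \<union> C) = (s + t) / 2" using C by (simp add: field_simps)
  moreover have "A \<inter> ((U - A) \<union> C) = C" "A \<union> ((U - A) \<union> C) = U" using A C by auto
  ultimately show ?thesis using U A C that[of A "(U - A) \<union> C"] by auto
qed

section \<open>Bounded random variables and the consequences of convexity\<close>

lemma compact_rvs_iff:
  assumes [measurable]: "X \<in> borel_measurable M"
  shows "X \<in> compact_rvs M \<longleftrightarrow> (\<exists>L. AE \<omega> in M. \<bar>X \<omega>\<bar> \<le> L)"
proof
  assume "X \<in> compact_rvs M"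
  then have D: "distr M borel X \<in> compact_distributions" by (simp add: compact_rvs_def)
  then interpret D: real_distribution "distr M borel X" by (rule compact_distributionsD)
  obtain L where "measure (distr M borel X) {-L..L} = 1"
    using compact_distributions_bounded[OF D] by blast
  then have "AE x in distr M borel X. \<bar>x\<bar> \<le> L" by (rule D.AE_bounded)
  then show "\<exists>L. AE \<omega> in M. \<bar>X \<omega>\<bar> \<le> L" by (subst (asm) AE_distr_iff) auto
next
  assume "\<exists>L. AE \<omega> in M. \<bar>X \<omega>\<bar> \<le> L"
  then obtain L where L: "AE \<omega> in M. \<bar>X \<omega>\<bar> \<le> L" by blast
  have "measure (distr M borel X) {-L..L} = prob (X -` {-L..L} \<inter> space M)"
    by (simp add: measure_distr)
  also have "\<dots> = 1" using L by (subst prob_eq_1) (auto elim!: eventually_mono)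
  finally show "X \<in> compact_rvs M"
    by (auto simp: compact_rvs_def compact_distributions_def intro!: exI[of _ "{-L..L}"])
qed

lemma compact_rvs_linear:
  assumes X: "X \<in> compact_rvs M" and Y: "Y \<in> compact_rvs M"
  shows "(\<lambda>\<omega>. a * X \<omega> + b * Y \<omega>) \<in> compact_rvs M"
proof -
  have [measurable]: "X \<in> borel_measurable M" "Y \<in> borel_measurable M"
    using X Y by (auto simp: compact_rvs_def)
  obtain L L' where "AE \<omega> in M. \<bar>X \<omega>\<bar> \<le> L" "AE \<omega> in M. \<bar>Y \<omega>\<bar> \<le> L'"
    using X Y by (auto simp: compact_rvs_iff)
  then have "AE \<omega> in M. \<bar>a * X \<omega> + b * Y \<omega>\<bar> \<le> \<bar>a\<bar> * L + \<bar>b\<bar> * L'"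
  proof eventually_elim
    case (elim \<omega>)
    then have "\<bar>a\<bar> * \<bar>X \<omega>\<bar> \<le> \<bar>a\<bar> * L" "\<bar>b\<bar> * \<bar>Y \<omega>\<bar> \<le> \<bar>b\<bar> * L'" by (auto intro: mult_left_mono)
    then show ?case using abs_triangle_ineq[of "a * X \<omega>" "b * Y \<omega>"] by (simp add: abs_mult)
  qed
  then show ?thesis by (auto simp: compact_rvs_iff)
qed

text \<open>The hinge condition is the sublinearity of the positive part, applied to
  \<open>a * (q - X) + b * (q' - Y)\<close>. Weights \<open>a = b = 1\<close> give superadditivity,
  weights with sum 1 give concavity.\<close>

lemma convex_imp_superadditive:
  assumes X: "X \<in> compact_rvs M" and Y: "Y \<in> compact_rvs M" and ab: "0 \<le> a" "0 \<le> b"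
    and h0: "h 0 = 0" and conv: "convex_on {0..1} h" and B: "\<And>x. x \<in> {0..1} \<Longrightarrow> \<bar>h x\<bar> \<le> B"
  shows "a * distortion_riskmetric h (distr M borel X) + b * distortion_riskmetric h (distr M borel Y)
    \<le> distortion_riskmetric h (distr M borel (\<lambda>\<omega>. a * X \<omega> + b * Y \<omega>))"
proof -
  have [measurable]: "X \<in> borel_measurable M" "Y \<in> borel_measurable M"
    using X Y by (auto simp: compact_rvs_def)
  have int: "integrable M Z" "integrable M (\<lambda>\<omega>. max 0 (q - Z \<omega>))" if Z: "Z \<in> compact_rvs M" for Z q
  proof -
    have [measurable]: "Z \<in> borel_measurable M" using Z by (simp add: compact_rvs_def)
    obtain L where "AE \<omega> in M. \<bar>Z \<omega>\<bar> \<le> L" using Z by (auto simp: compact_rvs_iff)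
    then show "integrable M Z" by (intro integrable_const_bound[of _ L]) auto
    then show "integrable M (\<lambda>\<omega>. max 0 (q - Z \<omega>))" by (intro integrable_max) auto
  qed
  note Z = compact_rvs_linear[OF X Y, of a b]
  show ?thesis
  proof (rule distortion_riskmetric_superadditive[OF _ _ _ ab _ _ h0 conv B])
    show "distr M borel X \<in> compact_distributions" "distr M borel Y \<in> compact_distributions"
      "distr M borel (\<lambda>\<omega>. a * X \<omega> + b * Y \<omega>) \<in> compact_distributions"
      using X Y Z by (auto simp: compact_rvs_def)
    show "(LINT x|distr M borel (\<lambda>\<omega>. a * X \<omega> + b * Y \<omega>). x) =
      a * (LINT x|distr M borel X. x) + b * (LINT x|distr M borel Y. x)"
      using int(1)[OF X] int(1)[OF Y] by (simp add: integral_distr)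
    fix q q'
    have "expectation (\<lambda>\<omega>. max 0 (a * q + b * q' - (a * X \<omega> + b * Y \<omega>)))
        \<le> expectation (\<lambda>\<omega>. a * max 0 (q - X \<omega>) + b * max 0 (q' - Y \<omega>))"
    proof (intro integral_mono int(2)[OF Z] Bochner_Integration.integrable_add integrable_mult_right int(2)[OF X] int(2)[OF Y])
      fix \<omega>
      have "a * (q - X \<omega>) \<le> a * max 0 (q - X \<omega>)" "b * (q' - Y \<omega>) \<le> b * max 0 (q' - Y \<omega>)"
        using ab by (auto intro: mult_left_mono)
      moreover have "0 \<le> a * max 0 (q - X \<omega>)" "0 \<le> b * max 0 (q' - Y \<omega>)" using ab by auto
      ultimately show "max 0 (a * q + b * q' - (a * X \<omega> + b * Y \<omega>)) \<le> a * max 0 (q - X \<omega>) + b * max 0 (q' - Y \<omega>)"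
        by (simp add: right_diff_distrib)
    qed
    then show "(LINT x|distr M borel (\<lambda>\<omega>. a * X \<omega> + b * Y \<omega>). max 0 (a * q + b * q' - x))
        \<le> a * (LINT x|distr M borel X. max 0 (q - x)) + b * (LINT x|distr M borel Y. max 0 (q' - x))"
      using int(2)[OF X] int(2)[OF Y] by (simp add: integral_distr)
  qed
qed

end

text \<open>The test functions \<open>x\<close> and \<open>-x\<close> force equal means, and the
  concave functions \<open>- max 0 (q - x)\<close> compare the hinge expectations. The
  superadditivity lemma is then used with weights 1 and 0.\<close>

lemma convex_imp_concave_order_monotone:
  assumes h0: "h 0 = 0" and conv: "convex_on {0..1} h" and B: "\<And>x. x \<in> {0..1} \<Longrightarrow> \<bar>h x\<bar> \<le> B"
  shows "concave_order_monotone (distortion_riskmetric h)"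
  unfolding concave_order_monotone_def
proof (intro ballI impI)
  fix F G assume F: "F \<in> compact_distributions" and G: "G \<in> compact_distributions"
    and le: "\<forall>f::real \<Rightarrow> real. concave_on UNIV f \<longrightarrow> (LINT x|F. f x) \<le> (LINT x|G. f x)"
  have hinge: "(LINT x|G. max 0 (q - x)) \<le> (LINT x|F. max 0 (q - x))" for q
  proof -
    have "concave_on UNIV (\<lambda>x. - max 0 (q - x))"
      unfolding concave_on_def minus_minus
    proof (rule convex_onI)
      fix l x y :: real assume l: "0 < l" "l < 1"
      have "(1 - l) * (q - x) \<le> (1 - l) * max 0 (q - x)" "l * (q - y) \<le> l * max 0 (q - y)"
        using l by (auto intro: mult_left_mono)
      moreover have "0 \<le> (1 - l) * max 0 (q - x)" "0 \<le> l * max 0 (q - y)" using l by auto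
      moreover have "q - ((1 - l) *\<^sub>R x + l *\<^sub>R y) = (1 - l) * (q - x) + l * (q - y)" by (simp add: algebra_simps)
      ultimately show "max 0 (q - ((1 - l) *\<^sub>R x + l *\<^sub>R y)) \<le> (1 - l) * max 0 (q - x) + l * max 0 (q - y)"
        by simp
    qed simp
    from le[rule_format, OF this] show ?thesis by simp
  qed
  have "concave_on UNIV (\<lambda>x::real. x)" "concave_on UNIV (\<lambda>x::real. - x)"
    by (auto simp: concave_on_ident concave_on_def convex_on_ident)
  from this[THEN le[rule_format]] have mean: "(LINT x|G. x) = (LINT x|F. x)" by simp
  show "distortion_riskmetric h F \<le> distortion_riskmetric h G"
    using distortion_riskmetric_superadditive[OF F F G, of 1 0 h B] mean hinge h0 conv B by simp
qed

section \<open>Step survival functions\<close>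

text \<open>For \<open>W 0 = 0\<close> and decreasing levels in \<open>{0..1}\<close> this is the
  survival function of a nonnegative discrete variable. The cells are closed on the left because
  survival functions with strict inequality are right-continuous.\<close>

definition step_survival :: "nat \<Rightarrow> (nat \<Rightarrow> real) \<Rightarrow> (nat \<Rightarrow> real) \<Rightarrow> real \<Rightarrow> real" where
  "step_survival N W v x = (if x < 0 then 1 else \<Sum>k<N. v k * indicator {W k..<W (Suc k)} x)"

lemma incseq_cells_disjoint:
  assumes "incseq (W :: nat \<Rightarrow> real)" "x \<in> {W j..<W (Suc j)}"
  shows "x \<in> {W k..<W (Suc k)} \<longleftrightarrow> k = j"
proof
  assume k: "x \<in> {W k..<W (Suc k)}"
  show "k = j"
  proof (rule ccontr)
    assume "k \<noteq> j"
    then consider "Suc k \<le> j" | "Suc j \<le> k" by linarith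
    then show False
      using k assms incseqD[OF assms(1)] by cases fastforce+
  qed
qed (use assms in simp)

lemma sum_indicator_cells:
  fixes W v :: "nat \<Rightarrow> real"
  assumes "incseq W" "x \<in> {W j..<W (Suc j)}" "j < N"
  shows "(\<Sum>k<N. v k * indicator {W k..<W (Suc k)} x) = v j"
proof -
  have "(\<Sum>k<N. v k * indicator {W k..<W (Suc k)} x) = (\<Sum>k<N. if k = j then v k else 0)"
    using incseq_cells_disjoint[OF assms(1,2)]
    by (intro sum.cong refl) (auto simp: indicator_def simp del: atLeastLessThan_iff)
  then show ?thesis using assms(3) by simp
qed

lemma distortion_riskmetric_step:
  assumes S: "\<And>x. measure F {x<..} = step_survival N W v x"
    and W: "W 0 = 0" "incseq W" and h0: "h 0 = 0"
  shows "distortion_riskmetric h F = (\<Sum>k<N. (W (Suc k) - W k) * h (v k))"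
proof -
  have W0: "0 \<le> W k" for k using incseqD[OF W(2), of 0 k] W(1) by simp
  have h_step: "h (step_survival N W v x) = (\<Sum>k<N. h (v k) * indicator {W k..<W (Suc k)} x)" if "0 \<le> x" for x
  proof (cases "\<exists>j<N. x \<in> {W j..<W (Suc j)}")
    case True
    then obtain j where j: "x \<in> {W j..<W (Suc j)}" "j < N" by blast
    have "(\<Sum>k<N. g k * indicator {W k..<W (Suc k)} x) = g j" for g :: "nat \<Rightarrow> real"
      by (rule sum_indicator_cells[OF W(2) j])
    then show ?thesis using that by (simp add: step_survival_def)
  next
    case False
    then have "(\<Sum>k<N. g k * indicator {W k..<W (Suc k)} x) = (0::real)" for g
      by (intro sum.neutral) (auto simp: indicator_def)
    then show ?thesis using that h0 by (simp add: step_survival_def)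
  qed
  have "(LBINT x:{0..}. h (measure F {x<..})) = (LBINT x. (\<Sum>k<N. h (v k) * indicator {W k..<W (Suc k)} x))"
    unfolding set_lebesgue_integral_def S
  proof (intro Bochner_Integration.integral_cong refl)
    fix x
    have "x < 0 \<Longrightarrow> x \<notin> {W k..<W (Suc k)}" for k using W0[of k] by auto
    then have "x < 0 \<Longrightarrow> (\<Sum>k<N. h (v k) * indicator {W k..<W (Suc k)} x) = 0"
      by (intro sum.neutral) (simp del: atLeastLessThan_iff)
    then show "indicator {0..} x *\<^sub>R h (step_survival N W v x) = (\<Sum>k<N. h (v k) * indicator {W k..<W (Suc k)} x)"
      using h_step[of x] by (cases "0 \<le> x") auto
  qed
  also have "\<dots> = (\<Sum>k<N. h (v k) * (W (Suc k) - W k))"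
    using incseq_SucD[OF W(2)]
    by (subst Bochner_Integration.integral_sum) (auto intro!: integrable_mult_right integrable_real_indicator)
  finally have pos: "(LBINT x:{0..}. h (measure F {x<..})) = (\<Sum>k<N. (W (Suc k) - W k) * h (v k))"
    by (simp add: mult.commute)
  \<comment> \<open>Below 0 the survival function is 1; only the null set consisting of the point 0
    can give a nonzero integrand.\<close>
  have "(LBINT x:{..0}. h (measure F {x<..}) - h 1) = 0"
    unfolding set_lebesgue_integral_def
  proof (rule integral_eq_zero_AE)
    show "AE x in lborel. indicator {..0} x *\<^sub>R (h (measure F {x<..}) - h 1) = 0"
      using AE_lborel_singleton[of "0::real"]
      by eventually_elim (auto simp: S step_survival_def indicator_def)
  qed
  then show ?thesis using pos by (simp add: distortion_riskmetric_def)
qed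

section \<open>Indicator variables and the midpoint inequality\<close>

context prob_space
begin

text \<open>The survival function is \<open>prob (A \<union> B)\<close> on the first cell of width
  \<open>c\<close> and \<open>prob (A \<inter> B)\<close> on the second. With \<open>c = 1\<close>
  this covers the sum of two indicators, with \<open>c = 1/2\<close> their average, and with
  \<open>A = B\<close> and \<open>c = 1/2\<close> a single indicator.\<close>

lemma distortion_riskmetric_two_indicators:
  assumes [measurable]: "A \<in> sets M" "B \<in> sets M" and c: "0 \<le> c" and h0: "h 0 = 0"
  shows "distortion_riskmetric h (distr M borel (\<lambda>\<omega>. c * (indicator A \<omega> + indicator B \<omega>)))
    = c * (h (prob (A \<union> B)) + h (prob (A \<inter> B)))"
proof -
  define W where "W k = c * real k" for k
  define v where "v k = (if k = 0 then prob (A \<union> B) else prob (A \<inter> B))" for k :: nat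
  have "measure (distr M borel (\<lambda>\<omega>. c * (indicator A \<omega> + indicator B \<omega>))) {x<..} = step_survival 2 W v x" for x
  proof -
    let ?E = "{\<omega> \<in> space M. x < c * (indicator A \<omega> + indicator B \<omega>)}"
    have AB: "A \<subseteq> space M" "B \<subseteq> space M" by (intro sets.sets_into_space assms)+
    have "x < 0 \<Longrightarrow> ?E = space M" using c by (auto simp: indicator_def)
    moreover have "0 \<le> x \<Longrightarrow> x < c \<Longrightarrow> ?E = A \<union> B" using c AB by (auto simp: indicator_def split: if_splits)
    moreover have "0 \<le> x \<Longrightarrow> c \<le> x \<Longrightarrow> x < 2 * c \<Longrightarrow> ?E = A \<inter> B"
      using c AB by (auto simp: indicator_def split: if_splits)
    moreover have "0 \<le> x \<Longrightarrow> 2 * c \<le> x \<Longrightarrow> ?E = {}" using c by (auto simp: indicator_def)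
    ultimately have "prob ?E = step_survival 2 W v x"
      using c by (auto simp: step_survival_def W_def v_def numeral_2_eq_2 indicator_def prob_space)
    moreover have "(\<lambda>\<omega>. c * (indicator A \<omega> + indicator B \<omega>)) -` {x<..} \<inter> space M = ?E" by auto
    ultimately show ?thesis by (simp add: measure_distr)
  qed
  then have "distortion_riskmetric h (distr M borel (\<lambda>\<omega>. c * (indicator A \<omega> + indicator B \<omega>)))
    = (\<Sum>k<2. (W (Suc k) - W k) * h (v k))"
  proof (rule distortion_riskmetric_step)
    show "W 0 = 0" "incseq W" using c by (auto simp: W_def incseq_def mult_left_mono)
  qed fact
  then show ?thesis by (simp add: numeral_2_eq_2 W_def v_def algebra_simps)
qed

lemma distortion_riskmetric_indicator:
  assumes "A \<in> sets M" "h 0 = 0"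
  shows "distortion_riskmetric h (distr M borel (indicator A)) = h (prob A)"
  using distortion_riskmetric_two_indicators[OF assms(1,1), of "1/2" h] assms(2) by simp

lemma indicator_in_compact_rvs: "A \<in> sets M \<Longrightarrow> indicator A \<in> compact_rvs M"
  by (auto simp: compact_rvs_iff indicator_def intro!: exI[of _ 1])

text \<open>The average of two identically distributed indicators dominates each of them in the
  concave order, by concavity of the test function at each sample point.\<close>

lemma concave_order_monotone_imp_midpoint:
  assumes na: "nonatomic M" and h0: "h 0 = 0" and mono: "concave_order_monotone (distortion_riskmetric h)"
    and st: "0 \<le> s" "s \<le> t" "t \<le> 1"
  shows "h ((s + t) / 2) \<le> (h s + h t) / 2"
proof -
  obtain A B where AB [measurable]: "A \<in> sets M" "B \<in> sets M" and
    P: "prob A = (s + t) / 2" "prob B = (s + t) / 2" "prob (A \<inter> B) = s" "prob (A \<union> B) = t"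
    using nonatomic_overlapping_pair[OF na st] by metis
  define Z where "Z \<omega> = 1/2 * indicator A \<omega> + 1/2 * (indicator B \<omega> :: real)" for \<omega>
  have Z: "Z \<in> compact_rvs M"
    unfolding Z_def using AB by (intro compact_rvs_linear indicator_in_compact_rvs)
  have [measurable]: "Z \<in> borel_measurable M" using Z by (simp add: compact_rvs_def)
  have "(LINT x|distr M borel (indicator A). f x) \<le> (LINT x|distr M borel Z. f x)"
    if f: "concave_on UNIV f" for f :: "real \<Rightarrow> real"
  proof -
    have "continuous_on UNIV (\<lambda>x. - f x)" using f by (intro convex_on_continuous) (auto simp: concave_on_def)
    then have "continuous_on UNIV f" using continuous_on_minus by fastforce
    then have [measurable]: "f \<in> borel_measurable borel" by (rule borel_measurable_continuous_onI)
    \<comment> \<open>An indicator takes only the values 0 and 1, so \<open>f\<close> may be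
      replaced by an affine function and the expectation depends on \<open>prob C\<close>
      alone.\<close>
    have fi: "f (indicator C \<omega>) = f 0 + (f 1 - f 0) * indicator C \<omega>" for C :: "'a set" and \<omega>
      by (simp add: indicator_def)
    have fE: "expectation (\<lambda>\<omega>. f (indicator C \<omega>)) = f 0 + (f 1 - f 0) * prob C"
      "integrable M (\<lambda>\<omega>. f (indicator C \<omega>))" if C: "C \<in> sets M" for C
    proof -
      have i: "integrable M (indicat_real C)" using C by (intro integrable_real_indicator) (auto simp: emeasure_eq_measure)
      then show "integrable M (\<lambda>\<omega>. f (indicator C \<omega>))" unfolding fi by auto
      show "expectation (\<lambda>\<omega>. f (indicator C \<omega>)) = f 0 + (f 1 - f 0) * prob C"
        unfolding fi using i C by (simp add: prob_space)
    qed
    have iZ: "integrable M (\<lambda>\<omega>. f (Z \<omega>))"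
      by (intro integrable_const_bound[of _ "\<bar>f 0\<bar> + \<bar>f (1/2)\<bar> + \<bar>f 1\<bar>"] AE_I2)
         (auto simp: Z_def indicator_def)
    have "expectation (\<lambda>\<omega>. f (indicator A \<omega>))
        = expectation (\<lambda>\<omega>. 1/2 * f (indicator A \<omega>) + 1/2 * f (indicator B \<omega>))"
      using fE(2) by (simp add: fE(1) P)
    also have "\<dots> \<le> expectation (\<lambda>\<omega>. f (Z \<omega>))"
    proof (intro integral_mono iZ)
      fix \<omega>
      show "1/2 * f (indicator A \<omega>) + 1/2 * f (indicator B \<omega>) \<le> f (Z \<omega>)"
        using concave_onD[OF f, of "1/2" "indicator A \<omega>" "indicator B \<omega>"] by (simp add: Z_def)
    qed (use fE(2) in auto)
    finally show ?thesis by (simp add: integral_distr)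
  qed
  then have "distortion_riskmetric h (distr M borel (indicator A)) \<le> distortion_riskmetric h (distr M borel Z)"
    using mono Z indicator_in_compact_rvs[OF AB(1)] unfolding concave_order_monotone_def compact_rvs_def by blast
  also have "Z = (\<lambda>\<omega>. 1/2 * (indicator A \<omega> + indicator B \<omega>))" by (simp add: Z_def fun_eq_iff)
  also have "distortion_riskmetric h (distr M borel \<dots>) = (h s + h t) / 2"
    using h0 AB by (subst distortion_riskmetric_two_indicators) (auto simp: P)
  finally show ?thesis using h0 AB by (simp add: distortion_riskmetric_indicator P)
qed

lemma o_superadditive_imp_midpoint:
  assumes na: "nonatomic M" and h0: "h 0 = 0" and sup: "o_superadditive M (distortion_riskmetric h)"
    and st: "0 \<le> s" "s \<le> t" "t \<le> 1"
  shows "h ((s + t) / 2) \<le> (h s + h t) / 2"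
proof -
  obtain A B where AB: "A \<in> sets M" "B \<in> sets M" and
    P: "prob A = (s + t) / 2" "prob B = (s + t) / 2" "prob (A \<inter> B) = s" "prob (A \<union> B) = t"
    using nonatomic_overlapping_pair[OF na st] by metis
  have "distortion_riskmetric h (distr M borel (indicator A)) + distortion_riskmetric h (distr M borel (indicator B))
      \<le> distortion_riskmetric h (distr M borel (\<lambda>\<omega>. indicator A \<omega> + indicator B \<omega>))"
    using sup AB indicator_in_compact_rvs unfolding o_superadditive_def by blast
  also have "\<dots> = h t + h s"
    using distortion_riskmetric_two_indicators[OF AB, of 1 h] h0 by (simp add: P)
  finally show ?thesis using h0 AB by (simp add: distortion_riskmetric_indicator P)
qed

text \<open>Both indicators have the same distribution, hence the same value
  \<open>h ((s + t) / 2)\<close>. The minimum is this value, so quasi-concavity is as strong here as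
  concavity.\<close>

lemma o_quasi_concave_imp_midpoint:
  assumes na: "nonatomic M" and h0: "h 0 = 0" and qc: "o_quasi_concave M (distortion_riskmetric h)"
    and st: "0 \<le> s" "s \<le> t" "t \<le> 1"
  shows "h ((s + t) / 2) \<le> (h s + h t) / 2"
proof -
  obtain A B where AB: "A \<in> sets M" "B \<in> sets M" and
    P: "prob A = (s + t) / 2" "prob B = (s + t) / 2" "prob (A \<inter> B) = s" "prob (A \<union> B) = t"
    using nonatomic_overlapping_pair[OF na st] by metis
  have "min (distortion_riskmetric h (distr M borel (indicator A))) (distortion_riskmetric h (distr M borel (indicator B)))
      \<le> distortion_riskmetric h (distr M borel (\<lambda>\<omega>. 1/2 * indicator A \<omega> + (1 - 1/2) * indicator B \<omega>))"
    using qc[unfolded o_quasi_concave_def, rule_format, OF indicator_in_compact_rvs[OF AB(1)] indicator_in_compact_rvs[OF AB(2)], of "1/2"]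
    by simp
  also have "(\<lambda>\<omega>. 1/2 * indicator A \<omega> + (1 - 1/2) * indicator B \<omega>) = (\<lambda>\<omega>. 1/2 * (indicator A \<omega> + indicator B \<omega> :: real))"
    by (simp add: fun_eq_iff)
  also have "distortion_riskmetric h (distr M borel \<dots>) = (h s + h t) / 2"
    using h0 AB by (subst distortion_riskmetric_two_indicators) (auto simp: P)
  finally show ?thesis using h0 AB by (simp add: distortion_riskmetric_indicator P)
qed

end

section \<open>Quasi-convexity along mixtures\<close>

text \<open>Each summand is built from indicators of open half-lines \<open>{..<c}\<close>, which
  are right-continuous; this gives the right continuity required of a distribution function.\<close>

lemma step_survival_eq_sum:
  assumes W: "W 0 = 0" "incseq W"
  shows "step_survival N W v x = indicator {..<0} x +
    (\<Sum>k<N. v k * (indicator {..<W (Suc k)} x - indicator {..<W k} x))"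
proof -
  have "W k \<le> W (Suc k)" for k using incseq_SucD[OF W(2)] .
  then have "indicator {W k..<W (Suc k)} x = (indicator {..<W (Suc k)} x - indicator {..<W k} x :: real)" for k
    by (auto simp: indicator_def dest: order.strict_trans2)
  moreover have "x < 0 \<Longrightarrow> x < W k" for k using incseqD[OF W(2), of 0 k] W(1) by simp
  ultimately show ?thesis by (auto simp: step_survival_def)
qed

lemma step_survival_cases:
  assumes W: "W 0 = 0" "incseq W"
  obtains "x < 0" "step_survival N W v x = 1"
  | j where "j < N" "x \<in> {W j..<W (Suc j)}" "step_survival N W v x = v j"
  | "W N \<le> x" "0 \<le> x" "step_survival N W v x = 0"
proof -
  have "(\<exists>j<N. x \<in> {W j..<W (Suc j)}) \<or> W N \<le> x" if "0 \<le> x"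
    using that W(1) by (induction N) (auto simp: less_Suc_eq)
  moreover have "step_survival N W v x = 0" if "W N \<le> x" "0 \<le> x"
  proof -
    have "x \<notin> {W k..<W (Suc k)}" if "k < N" for k
      using incseqD[OF W(2), of "Suc k" N] that \<open>W N \<le> x\<close> by auto
    then show ?thesis using that by (auto simp: step_survival_def intro!: sum.neutral)
  qed
  moreover have "step_survival N W v x = v j" if "j < N" "x \<in> {W j..<W (Suc j)}" for j
  proof -
    have "0 \<le> x" using that incseqD[OF W(2), of 0 j] W(1) by simp
    then show ?thesis using sum_indicator_cells[OF W(2) that(2,1)] by (simp add: step_survival_def)
  qed
  moreover have "x < 0 \<Longrightarrow> step_survival N W v x = 1" by (simp add: step_survival_def)
  ultimately show ?thesis using that by (meson not_less)
qed

lemma step_survival_antimono: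
  assumes W: "W 0 = 0" "incseq W" and v: "\<And>j k. j \<le> k \<Longrightarrow> k < N \<Longrightarrow> v k \<le> v j"
    "\<And>k. k < N \<Longrightarrow> v k \<in> {0..1}" and xy: "x \<le> y"
  shows "step_survival N W v y \<le> step_survival N W v x"
proof (cases rule: step_survival_cases[OF W, of y N v])
  case 1
  then show ?thesis using xy by (simp add: step_survival_def)
next
  case (2 k)
  show ?thesis
  proof (cases rule: step_survival_cases[OF W, of x N v])
    case 1
    then show ?thesis using 2 v(2)[of k] by simp
  next
    case (2 j)
    have "j \<le> k"
      using 2 \<open>y \<in> {W k..<W (Suc k)}\<close> xy incseqD[OF W(2), of "Suc k" j] by (cases "j \<le> k") auto
    then show ?thesis using 2 \<open>k < N\<close> \<open>step_survival N W v y = v k\<close> v(1) by simp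
  next
    case 3
    then show ?thesis using \<open>k < N\<close> \<open>y \<in> {W k..<W (Suc k)}\<close> xy incseqD[OF W(2), of "Suc k" N] by auto
  qed
next
  case 3
  have "0 \<le> step_survival N W v x"
    by (cases rule: step_survival_cases[OF W, of x N v]) (use v(2) in auto)
  then show ?thesis using 3 by simp
qed

lemma exists_step_distribution:
  assumes W: "W 0 = 0" "incseq W" and v: "\<And>j k. j \<le> k \<Longrightarrow> k < N \<Longrightarrow> v k \<le> v j"
    "\<And>k. k < N \<Longrightarrow> v k \<in> {0..1}"
  obtains F where "F \<in> compact_distributions" "\<And>x. measure F {x<..} = step_survival N W v x"
proof -
  define C where "C x = 1 - step_survival N W v x" for x
  have WN: "0 \<le> W N" using incseqD[OF W(2), of 0 N] W(1) by simp
  have C_low: "C x = 0" if "x < 0" for x using that by (simp add: C_def step_survival_def)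
  have C_high: "C x = 1" if "W N \<le> x" for x
  proof (cases rule: step_survival_cases[OF W, of x N v])
    case 1
    then show ?thesis using that WN by simp
  next
    case (2 j)
    then show ?thesis using that incseqD[OF W(2), of "Suc j" N] by auto
  qed (simp add: C_def)
  have C_mono: "C x \<le> C y" if "x \<le> y" for x y
    unfolding C_def using step_survival_antimono[of W N v x y] W v that by simp
  have ind: "((\<lambda>x. indicator {..<c} x :: real) \<longlongrightarrow> indicator {..<c} a) (at_right a)" for a c :: real
  proof (rule tendsto_eventually)
    show "\<forall>\<^sub>F x in at_right a. (indicator {..<c} x :: real) = indicator {..<c} a"
    proof (cases "a < c")
      case True
      then show ?thesis by (auto simp: eventually_at_right indicator_def intro!: exI[of _ c])
    next
      case False
      then show ?thesis
        using eventually_at_right_less[of a] by (auto elim!: eventually_mono simp: indicator_def)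
    qed
  qed
  have C_right: "continuous (at_right a) C" for a
    unfolding C_def step_survival_eq_sum[OF W] continuous_within by (intro tendsto_intros ind)
  have C_bot: "(C \<longlongrightarrow> 0) at_bot"
    by (rule tendsto_eventually) (auto simp: eventually_at_bot_linorder intro!: exI[of _ "-1"] C_low)
  have C_top: "(C \<longlongrightarrow> 1) at_top"
    by (rule tendsto_eventually) (auto simp: eventually_at_top_linorder intro!: exI[of _ "W N"] C_high)
  define F where "F = interval_measure C"
  interpret F: real_distribution F
    unfolding F_def using C_mono C_right C_bot C_top by (rule real_distribution_interval_measure)
  have cdf: "cdf F = C"
    unfolding F_def using C_mono C_right C_bot by (rule cdf_interval_measure)
  have "measure F {x<..} = step_survival N W v x" for x
    using fun_cong[OF cdf, of x] by (simp add: F.survival_eq_cdf cdf_def C_def)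
  \<comment> \<open>The difference of the distribution function measures a half-open interval, so
    the left end is moved to -1, where the distribution function is still 0.\<close>
  moreover have "measure F {-1..W N} = 1"
  proof -
    have "measure F {-1<..W N} = C (W N) - C (-1)"
      using F.cdf_diff_eq[of "-1" "W N"] WN cdf by simp
    also have "\<dots> = 1" by (simp add: C_low C_high)
    finally have "1 \<le> measure F {-1..W N}"
      using F.finite_measure_mono[of "{-1<..W N}" "{-1..W N}"] by fastforce
    then show ?thesis using F.prob_le_1 by (intro antisym) auto
  qed
  then have "F \<in> compact_distributions"
    using F.real_distribution_axioms by (auto simp: compact_distributions_def)
  ultimately show ?thesis using that by blast
qed

text \<open>Both distributions use the same cells, so their mixture with weight 1/2 has the midpoint
  levels on these cells.\<close>

lemma p_quasi_convex_steps:
  assumes qc: "p_quasi_convex (distortion_riskmetric h)" and h0: "h 0 = 0"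
    and W: "W 0 = 0" "incseq W"
    and v: "\<And>j k. j \<le> k \<Longrightarrow> k < N \<Longrightarrow> v k \<le> v j" "\<And>k. k < N \<Longrightarrow> v k \<in> {0..1}"
    and u: "\<And>j k. j \<le> k \<Longrightarrow> k < N \<Longrightarrow> u k \<le> u j" "\<And>k. k < N \<Longrightarrow> u k \<in> {0..1}"
  shows "(\<Sum>k<N. (W (Suc k) - W k) * h ((v k + u k) / 2))
    \<le> max (\<Sum>k<N. (W (Suc k) - W k) * h (v k)) (\<Sum>k<N. (W (Suc k) - W k) * h (u k))"
proof -
  obtain F where F: "F \<in> compact_distributions" "\<And>x. measure F {x<..} = step_survival N W v x"
    using exists_step_distribution[of W N v] W v by blast
  obtain G where G: "G \<in> compact_distributions" "\<And>x. measure G {x<..} = step_survival N W u x"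
    using exists_step_distribution[of W N u] W u by blast
  have "step_survival N W (\<lambda>k. (v k + u k) / 2) x = step_survival N W v x / 2 + step_survival N W u x / 2" for x
  proof -
    have "(\<Sum>k<N. (v k + u k) / 2 * indicator {W k..<W (Suc k)} x)
        = (\<Sum>k<N. v k * indicator {W k..<W (Suc k)} x) / 2 + (\<Sum>k<N. u k * indicator {W k..<W (Suc k)} x) / 2"
      unfolding sum_divide_distrib sum.distrib[symmetric] by (intro sum.cong) (auto simp: indicator_def add_divide_distrib)
    then show ?thesis by (simp add: step_survival_def)
  qed
  then have mix: "measure (mixture (1/2) F G) {x<..} = step_survival N W (\<lambda>k. (v k + u k) / 2) x" for x
    using measure_mixture[of F G "1/2" "{x<..}"] F G by (simp add: compact_distributionsD)
  have "distortion_riskmetric h (mixture (1/2) F G) \<le> max (distortion_riskmetric h F) (distortion_riskmetric h G)"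
    using qc[unfolded p_quasi_convex_def, rule_format, OF F(1) G(1), of "1/2"] by simp
  then show ?thesis
    unfolding distortion_riskmetric_step[where h = h, OF mix W h0] distortion_riskmetric_step[where h = h, OF F(2) W h0]
      distortion_riskmetric_step[where h = h, OF G(2) W h0] .
qed

text \<open>A block of width 1 at level a (resp. b) next to cells of width w at the levels c (resp. c').\<close>

lemma p_quasi_convex_block:
  fixes c c' :: "nat \<Rightarrow> real"
  assumes qc: "p_quasi_convex (distortion_riskmetric h)" and h0: "h 0 = 0" and w: "0 \<le> w"
    and ab: "a \<in> {0..1}" "b \<in> {0..1}"
    and c: "\<And>j k. j \<le> k \<Longrightarrow> k < N \<Longrightarrow> c k \<le> c j" "\<And>k. k < N \<Longrightarrow> c k \<in> {0..1}"
    and c': "\<And>j k. j \<le> k \<Longrightarrow> k < N \<Longrightarrow> c' k \<le> c' j" "\<And>k. k < N \<Longrightarrow> c' k \<in> {0..1}"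
    and sep: "(\<forall>k<N. c k \<le> a \<and> c' k \<le> b) \<or> (\<forall>k<N. a \<le> c k \<and> b \<le> c' k)"
  shows "h ((a + b) / 2) + w * (\<Sum>k<N. h ((c k + c' k) / 2))
    \<le> max (h a + w * (\<Sum>k<N. h (c k))) (h b + w * (\<Sum>k<N. h (c' k)))"
  using sep
proof
  assume low: "\<forall>k<N. c k \<le> a \<and> c' k \<le> b"
  \<comment> \<open>Levels must decrease, so the higher block is the first cell;
    \<open>case_nat\<close> puts its level in front of the others.\<close>
  define W where "W k = (case k of 0 \<Rightarrow> 0 | Suc i \<Rightarrow> 1 + w * real i)" for k
  have "W k \<le> W (Suc k)" for k using w by (cases k) (auto simp: W_def algebra_simps)
  then have W: "W 0 = 0" "incseq W" by (auto simp: incseq_SucI) (simp add: W_def)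
  have cell: "W (Suc (Suc k)) - W (Suc k) = w" "W (Suc 0) = 1" for k by (auto simp: W_def algebra_simps)
  have "(\<Sum>k<Suc N. (W (Suc k) - W k) * h ((case_nat a c k + case_nat b c' k) / 2))
    \<le> max (\<Sum>k<Suc N. (W (Suc k) - W k) * h (case_nat a c k)) (\<Sum>k<Suc N. (W (Suc k) - W k) * h (case_nat b c' k))"
    by (intro p_quasi_convex_steps[OF qc h0 W]) (use ab c c' low in \<open>auto split: nat.splits\<close>)
  then show ?thesis
    by (simp add: sum.lessThan_Suc_shift cell W(1) sum_distrib_left del: sum.lessThan_Suc)
next
  assume high: "\<forall>k<N. a \<le> c k \<and> b \<le> c' k"
  \<comment> \<open>The block has the lowest level and comes last, as cell number
    \<open>N\<close>.\<close>
  define W where "W k = (if k \<le> N then w * real k else w * real N + 1)" for k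
  have "W k \<le> W (Suc k)" for k
    using w by (cases "k < N"; cases "k = N") (auto simp: W_def intro!: mult_left_mono)
  then have W: "W 0 = 0" "incseq W" by (auto simp: incseq_SucI) (simp add: W_def)
  have cell: "W (Suc k) - W k = w" if "k < N" for k using that by (simp add: W_def algebra_simps)
  have block: "W (Suc N) - W N = 1" by (simp add: W_def)
  have "(\<Sum>k<Suc N. (W (Suc k) - W k) * h (((if k < N then c k else a) + (if k < N then c' k else b)) / 2))
    \<le> max (\<Sum>k<Suc N. (W (Suc k) - W k) * h (if k < N then c k else a)) (\<Sum>k<Suc N. (W (Suc k) - W k) * h (if k < N then c' k else b))"
    by (intro p_quasi_convex_steps[OF qc h0 W]) (use ab c c' high in auto)
  then show ?thesis
    by (simp add: block cell sum_distrib_left add.commute)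
qed

text \<open>The staircases \<open>v\<^sub>0, \<dots>, v\<^sub>n\<close> and \<open>v\<^sub>2, \<dots>, v\<^sub>n\<^sub>+\<^sub>2\<close> have the midpoint \<open>v\<^sub>1, \<dots>, v\<^sub>n\<^sub>+\<^sub>1\<close>.
  Their values differ by about \<open>2 (h q - h p)\<close> per unit of width, which compensates
  \<open>h t - h s\<close>, while by telescoping the convexity defect of the staircases vanishes as the steps are refined.\<close>

lemma p_quasi_convex_imp_midpoint:
  assumes qc: "p_quasi_convex (distortion_riskmetric h)" and h0: "h 0 = 0"
    and st: "0 \<le> s" "s \<le> t" "t \<le> 1" and pq: "0 \<le> p" "p < q" "q \<le> 1" and sep: "q \<le> s \<or> t \<le> p"
    and hpq: "h p \<noteq> h q"
    and cont: "continuous (at p within {0..1}) h" "continuous (at q within {0..1}) h"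
  shows "h ((s + t) / 2) \<le> (h s + h t) / 2"
proof -
  \<comment> \<open>There are \<open>n + 2\<close> steps because the two shifted staircases together
    use the levels from \<open>v n 0 = q\<close> to \<open>v n (n + 2) = p\<close>.\<close>
  define d where "d n = (q - p) / real (n + 2)" for n
  define v where "v n k = q - real k * d n" for n k
  define g where "g n k = h (v n k) - h (v n (Suc k))" for n k
  define E where "E n = (\<Sum>k<Suc n. h (v n k) - h (v n (k + 2)))" for n
  define T where "T n = g n 0 - g n (Suc n)" for n
  have d: "0 < d n" for n using pq by (simp add: d_def)
  have v_end: "v n (n + 2) = p" for n by (simp add: v_def d_def field_simps)
  have v_bnd: "v n k \<in> {p..q}" if "k \<le> n + 2" for n k
  proof -
    have "real k * d n \<le> real (n + 2) * d n" using that d[of n] by (intro mult_right_mono) auto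
    also have "\<dots> = q - p" by (simp add: d_def)
    finally show ?thesis using d[of n] by (simp add: v_def)
  qed
  have v_01: "v n k \<in> {0..1}" if "k \<le> n + 2" for n k using v_bnd[OF that] pq by auto
  have v_anti: "v n k \<le> v n j" if "j \<le> k" for n j k
    using that d[of n] by (auto simp: v_def intro!: mult_right_mono)
  have v_mid: "(v n k + v n (k + 2)) / 2 = v n (Suc k)" for n k by (simp add: v_def field_simps)
  have d0: "d \<longlonglongrightarrow> 0"
    unfolding d_def by (rule LIMSEQ_ignore_initial_segment[of "\<lambda>n. (q - p) / real n"])
      (rule lim_const_over_n)
  have lim: "(\<lambda>n. h (f n)) \<longlonglongrightarrow> h x"
    if "continuous (at x within {0..1}) h" "\<And>n. f n \<in> {0..1}" "f \<longlonglongrightarrow> x" for f x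
    using that unfolding continuous_within_sequentially by (auto simp: o_def)
  have "v n 1 = q - d n" for n by (simp add: v_def)
  then have "(\<lambda>n. v n 1) \<longlonglongrightarrow> q - 0" by (simp only:) (intro tendsto_intros d0)
  then have lim_q: "(\<lambda>n. h (v n 1)) \<longlonglongrightarrow> h q" by (intro lim cont v_01) auto
  have v_pre: "v n (Suc n) = p + d n" for n
    using v_end[of n] by (simp add: v_def algebra_simps)
  have "(\<lambda>n. v n (Suc n)) \<longlonglongrightarrow> p + 0" unfolding v_pre by (intro tendsto_intros d0)
  then have lim_p: "(\<lambda>n. h (v n (Suc n))) \<longlonglongrightarrow> h p" by (intro lim cont v_01) auto
  have v0: "v n 0 = q" for n by (simp add: v_def)
  \<comment> \<open>The telescoped defect involves only the first and the last step, so continuity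
    at \<open>q\<close> and \<open>p\<close> makes it vanish.\<close>
  have "T = (\<lambda>n. (h q - h (v n 1)) - (h (v n (Suc n)) - h p))"
    using v_end by (auto simp: T_def g_def v0)
  then have T: "T \<longlonglongrightarrow> (h q - h q) - (h p - h p)"
    by (simp only:) (intro tendsto_intros lim_p lim_q)
  have E_eq: "E n = (h (v n 0) + h (v n 1)) - (h (v n (Suc n)) + h (v n (n + 2)))" for n
  proof -
    define f where "f k = h (v n k) + h (v n (Suc k))" for k
    have "E n = (\<Sum>k<Suc n. f k - f (Suc k))"
      unfolding E_def by (intro sum.cong) (auto simp: f_def)
    also have "\<dots> = f 0 - f (Suc n)" by (rule sum_lessThan_telescope')
    finally show ?thesis by (simp add: f_def)
  qed
  have "E = (\<lambda>n. (h q + h (v n 1)) - (h (v n (Suc n)) + h p))"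
    by (simp add: fun_eq_iff E_eq v0 v_end del: One_nat_def add_2_eq_Suc')
  then have E: "E \<longlonglongrightarrow> (h q + h q) - (h p + h p)"
    by (simp only:) (intro tendsto_intros lim_p lim_q)
  have T_eq: "T n = (\<Sum>k<Suc n. h (v n k) - 2 * h (v n (Suc k)) + h (v n (k + 2)))" for n
  proof -
    have "T n = (\<Sum>k<Suc n. g n k - g n (Suc k))" unfolding T_def by (rule sum_lessThan_telescope'[symmetric])
    also have "\<dots> = (\<Sum>k<Suc n. h (v n k) - 2 * h (v n (Suc k)) + h (v n (k + 2)))"
      by (intro sum.cong) (auto simp: g_def)
    finally show ?thesis .
  qed
  have main: "2 * h ((s + t) / 2) - h s - h t \<le> \<bar>h t - h s\<bar> / \<bar>E n\<bar> * T n" if "E n \<noteq> 0" for n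
  proof -
    \<comment> \<open>The width is chosen so that the staircases offset the difference between
      \<open>h s\<close> and \<open>h t\<close>. Their difference \<open>E n\<close> may have the
      wrong sign, and then \<open>s\<close> and \<open>t\<close> exchange roles as \<open>a\<close>
      and \<open>b\<close>.\<close>
    define w where "w = \<bar>h t - h s\<bar> / \<bar>E n\<bar>"
    have w: "0 \<le> w" by (simp add: w_def)
    have "\<bar>w * E n\<bar> = \<bar>h t - h s\<bar>" using that by (simp add: w_def abs_mult)
    then obtain a b where ab: "a = s \<and> b = t \<or> a = t \<and> b = s" "h a + w * E n = h b"
      by (cases "w * E n = h t - h s") (force, smt (verit))
    define S where "S i = (\<Sum>k<Suc n. h (v n (k + i)))" for i
    have ES: "E n = S 0 - S 2" by (simp only: E_def S_def sum_subtractf add_0_right)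
    have TS: "T n = S 0 - 2 * S 1 + S 2"
      by (simp only: T_eq S_def sum_subtractf sum.distrib add_0_right sum_distrib_left Suc_eq_plus1)
    have "h ((a + b) / 2) + w * (\<Sum>k<Suc n. h ((v n k + v n (k + 2)) / 2))
        \<le> max (h a + w * (\<Sum>k<Suc n. h (v n k))) (h b + w * (\<Sum>k<Suc n. h (v n (k + 2))))"
    proof (rule p_quasi_convex_block[OF qc h0 w])
      show "a \<in> {0..1}" "b \<in> {0..1}" using ab(1) st by auto
      have cells: "p \<le> v n k" "v n k \<le> q" "p \<le> v n (k + 2)" "v n (k + 2) \<le> q" if "k < Suc n" for k
        using v_bnd[of k n] v_bnd[of "k + 2" n] that by auto
      have "s \<le> a" "s \<le> b" "a \<le> t" "b \<le> t" using ab(1) st by auto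
      then show "(\<forall>k<Suc n. v n k \<le> a \<and> v n (k + 2) \<le> b) \<or> (\<forall>k<Suc n. a \<le> v n k \<and> b \<le> v n (k + 2))"
        using sep cells by (meson order_trans)
      fix k assume "k < Suc n"
      then show "v n k \<in> {0..1}" "v n (k + 2) \<in> {0..1}" by (auto intro!: v_01 simp del: atLeastAtMost_iff)
    qed (auto intro!: v_anti)
    then have "h ((a + b) / 2) + w * S 1 \<le> max (h a + w * S 0) (h b + w * S 2)"
      unfolding v_mid S_def by simp
    \<comment> \<open>Both distributions have the same value, so the maximum equals the average and
      quasi-convexity yields a genuine midpoint inequality.\<close>
    moreover have "h a + w * S 0 = h b + w * S 2"
      using ab(2) unfolding ES by (simp add: algebra_simps)
    ultimately have "2 * h ((a + b) / 2) + 2 * (w * S 1) \<le> h a + h b + w * S 0 + w * S 2" by simp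
    then have "2 * h ((a + b) / 2) - h a - h b \<le> w * T n" unfolding TS by (simp add: algebra_simps)
    then show ?thesis using ab(1) unfolding w_def by (auto simp: add.commute)
  qed
  have "(\<lambda>n. \<bar>h t - h s\<bar> / \<bar>E n\<bar> * T n) \<longlonglongrightarrow>
      \<bar>h t - h s\<bar> / \<bar>(h q + h q) - (h p + h p)\<bar> * ((h q - h q) - (h p - h p))"
    using hpq by (intro tendsto_intros E T) auto
  moreover have "\<forall>\<^sub>F n in sequentially. E n \<noteq> 0"
    using hpq by (intro tendsto_imp_eventually_ne[OF E]) auto
  then have "\<forall>\<^sub>F n in sequentially. 2 * h ((s + t) / 2) - h s - h t \<le> \<bar>h t - h s\<bar> / \<bar>E n\<bar> * T n"
    by (rule eventually_mono) (rule main)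
  ultimately have "2 * h ((s + t) / 2) - h s - h t
      \<le> \<bar>h t - h s\<bar> / \<bar>(h q + h q) - (h p + h p)\<bar> * ((h q - h q) - (h p - h p))"
    by (rule tendsto_lowerbound) simp
  then show ?thesis by simp
qed

text \<open>At the points \<open>x - e\<close>, \<open>x + e\<close> of a violation no staircase can
  be available. Hence \<open>h (x - e) = h 0\<close> and \<open>h (x + e) = h 1\<close> for all
  small \<open>e\<close>. Letting \<open>e\<close> tend to 0 gives \<open>h x = h 0 = h 1\<close>,
  which contradicts the strict violation.\<close>

lemma p_quasi_convex_continuous_imp_convex:
  assumes qc: "p_quasi_convex (distortion_riskmetric h)" and h0: "h 0 = 0"
    and cont: "continuous_on {0..1} h"
  shows "convex_on {0..1} h"
proof (rule ccontr)
  assume "\<not> ?thesis"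
  then obtain x d where d: "0 < d" "0 \<le> x - d" "x + d \<le> 1"
    and viol: "\<And>e. 0 < e \<Longrightarrow> e \<le> d \<Longrightarrow> (h (x - e) + h (x + e)) / 2 < h x"
    using continuous_not_convex_midpoint[OF cont] by metis
  have cx: "continuous (at y within {0..1}) h" if "y \<in> {0..1}" for y
    using cont that by (simp add: continuous_on_eq_continuous_within)
  have left: "h (x - e) = h 0" if e: "0 < e" "e \<le> d" for e
  proof (rule ccontr)
    assume ne: "h (x - e) \<noteq> h 0"
    then have "0 < x - e" using e d by (cases "x - e = 0") auto
    then have "h ((x - e + (x + e)) / 2) \<le> (h (x - e) + h (x + e)) / 2"
      using e d ne by (intro p_quasi_convex_imp_midpoint[OF qc h0, where p = 0 and q = "x - e"] cx) auto
    then show False using viol[OF e] by simp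
  qed
  have right: "h (x + e) = h 1" if e: "0 < e" "e \<le> d" for e
  proof (rule ccontr)
    assume ne: "h (x + e) \<noteq> h 1"
    then have "x + e < 1" using e d by (cases "x + e = 1") auto
    then have "h ((x - e + (x + e)) / 2) \<le> (h (x - e) + h (x + e)) / 2"
      using e d ne by (intro p_quasi_convex_imp_midpoint[OF qc h0, where p = "x + e" and q = 1] cx) auto
    then show False using viol[OF e] by simp
  qed
  define e where "e n = d / real (Suc n)" for n
  have e: "0 < e n" "e n \<le> d" for n using d by (auto simp: e_def field_simps)
  have e01: "x - e n \<in> {0..1}" "x + e n \<in> {0..1}" for n using e(1)[of n] e(2)[of n] d by auto
  have e0: "e \<longlonglongrightarrow> 0" unfolding e_def by (rule LIMSEQ_Suc[OF lim_const_over_n])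
  have lim: "(\<lambda>n. h (f n)) \<longlonglongrightarrow> h x" if "\<And>n. f n \<in> {0..1}" "f \<longlonglongrightarrow> x" for f
  proof -
    have "x \<in> {0..1}" using d by auto
    then show ?thesis
      using cx[unfolded continuous_within_sequentially] that by (auto simp: o_def)
  qed
  have "(\<lambda>n. x - e n) \<longlonglongrightarrow> x - 0" "(\<lambda>n. x + e n) \<longlonglongrightarrow> x + 0" by (intro tendsto_intros e0)+
  then have "(\<lambda>n. h (x - e n)) \<longlonglongrightarrow> h x" "(\<lambda>n. h (x + e n)) \<longlonglongrightarrow> h x"
    using e01 by (auto intro!: lim simp del: atLeastAtMost_iff)
  then have "h 0 = h x" "h 1 = h x"
    using left right e LIMSEQ_const_iff[of "h 0" "h x"] LIMSEQ_const_iff[of "h 1" "h x"] by auto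
  then show False using viol[of d] left[of d] right[of d] d by simp
qed

text \<open>A monotone function has only countably many discontinuities, so every interval contains
  continuity points, and strict monotonicity gives \<open>h\<close> different values at
  them.\<close>

lemma p_quasi_convex_monotone_imp_convex:
  assumes qc: "p_quasi_convex (distortion_riskmetric h)" and h0: "h 0 = 0"
    and mono: "strict_mono_on {0..1} h \<or> strict_antimono_on {0..1} h"
  shows "convex_on {0..1} h"
proof -
  have inj: "h x \<noteq> h y" if "x \<in> {0..1}" "y \<in> {0..1}" "x < y" for x y
    using mono that by (force simp: monotone_on_def)
  have cont_pt: "\<exists>x\<in>{a<..<b}. isCont h x" if ab: "0 \<le> a" "a < b" "b \<le> 1" for a b
  proof -
    have "countable {x\<in>{a<..<b}. \<not> isCont h x}"
      using mono
    proof
      assume "strict_mono_on {0..1} h"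
      then have "mono_on {a<..<b} h"
        using ab by (intro monotone_on_subset[OF strict_mono_on_imp_mono_on]) auto
      then show ?thesis by (intro mono_on_ctble_discont_open) auto
    next
      assume "strict_antimono_on {0..1} h"
      then have "strict_mono_on {0..1} (\<lambda>x. - h x)" by (simp add: monotone_on_def)
      then have "mono_on {a<..<b} (\<lambda>x. - h x)"
        using ab by (intro monotone_on_subset[OF strict_mono_on_imp_mono_on]) auto
      then have "countable {x\<in>{a<..<b}. \<not> isCont (\<lambda>x. - h x) x}" by (intro mono_on_ctble_discont_open) auto
      moreover have "isCont (\<lambda>x. - h x) x \<longleftrightarrow> isCont h x" for x
        using isCont_minus[of x h] isCont_minus[of x "\<lambda>x. - h x"] by auto
      ultimately show ?thesis by simp
    qed
    moreover have "uncountable {a<..<b}" using ab by (simp add: uncountable_open_interval)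
    ultimately have "{x\<in>{a<..<b}. \<not> isCont h x} \<noteq> {a<..<b}" by metis
    then show ?thesis by blast
  qed
  have proper: "h ((s + t) / 2) \<le> (h s + h t) / 2" if st: "0 \<le> s" "s \<le> t" "t \<le> 1" "0 < s \<or> t < 1" for s t
  proof -
    \<comment> \<open>The room for the staircase is \<open>{0..s}\<close> or \<open>{t..1}\<close>,
      whichever is nondegenerate.\<close>
    obtain a b where ab: "0 \<le> a" "a < b" "b \<le> 1" "b \<le> s \<or> t \<le> a"
      using st by (metis order_refl order_trans)
    obtain p where p: "p \<in> {a<..<(a + b) / 2}" "isCont h p" using cont_pt[of a "(a + b) / 2"] ab by auto
    obtain q where q: "q \<in> {(a + b) / 2<..<b}" "isCont h q" using cont_pt[of "(a + b) / 2" b] ab by auto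
    have pq: "a < p" "p < q" "q < b" using p q by auto
    show ?thesis
    proof (rule p_quasi_convex_imp_midpoint[OF qc h0 st(1-3)])
      show "0 \<le> p" "p < q" "q \<le> 1" "q \<le> s \<or> t \<le> p" using pq ab by auto
      show "h p \<noteq> h q" using pq ab by (intro inj) auto
    qed (rule continuous_at_imp_continuous_at_within, fact)+
  qed
  \<comment> \<open>The pair 0, 1 leaves no room for a staircase. The inequalities at 1/4 and 3/4
    are inserted into the one at 1/2, and the resulting term in \<open>h (1/2)\<close> has
    coefficient 1/2 and is absorbed on the left.\<close>
  have whole: "h (1/2) \<le> (h 0 + h 1) / 2"
    using proper[of 0 "1/2"] proper[of "1/2" 1] proper[of "1/4" "3/4"] by simp
  show ?thesis
  proof (rule midpoint_convex_imp_convex_on)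
    fix s t :: real assume st: "0 \<le> s" "s \<le> t" "t \<le> 1"
    show "h ((s + t) / 2) \<le> (h s + h t) / 2"
    proof (cases "0 < s \<or> t < 1")
      case False
      then have "s = 0" "t = 1" using st by auto
      then show ?thesis using whole by simp
    qed (use proper st in blast)
  next
    fix x :: real assume "x \<in> {0..1}"
    then have "x = 0 \<or> x = 1 \<or> x \<in> {0<..<1}" by auto
    then show "h x \<le> max (h 0) (h 1)"
      using mono by (force simp: monotone_on_def le_max_iff_disj)
  qed
qed

lemma H_BV_bounded:
  assumes "h \<in> H_BV"
  obtains B where "\<And>x. x \<in> {0..1} \<Longrightarrow> \<bar>h x\<bar> \<le> B"
proof -
  obtain B where B: "\<And>n (t :: nat \<Rightarrow> real). (\<forall>i\<le>n. t i \<in> {0..1}) \<Longrightarrow> mono_on {..n} t \<Longrightarrow>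
      (\<Sum>i<n. \<bar>h (t (Suc i)) - h (t i)\<bar>) \<le> B"
    using assms unfolding H_BV_def bounded_variation_Icc_def by blast
  \<comment> \<open>The partition with the two points 0 and \<open>x\<close> suffices, since
    \<open>h 0 = 0\<close>.\<close>
  have "\<bar>h x\<bar> \<le> B" if "x \<in> {0..1}" for x
    using B[of 1 "\<lambda>i. if i = 0 then 0 else x"] that assms by (auto simp: H_BV_def monotone_on_def)
  then show ?thesis using that by blast
qed

theorem theorem3:
  fixes M :: "'a measure" and h :: "real \<Rightarrow> real"
  assumes "prob_space M" and "nonatomic M"
    and "h \<in> H_BV"
    and "continuous_on {0..1} h \<or> strict_mono_on {0..1} h \<or> strict_antimono_on {0..1} h"
  shows "(convex_on {0..1} h \<longleftrightarrow> concave_order_monotone (distortion_riskmetric h)) \<and>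
         (convex_on {0..1} h \<longleftrightarrow> o_superadditive M (distortion_riskmetric h)) \<and>
         (convex_on {0..1} h \<longleftrightarrow> o_concave M (distortion_riskmetric h)) \<and>
         (convex_on {0..1} h \<longleftrightarrow> o_quasi_concave M (distortion_riskmetric h)) \<and>
         (convex_on {0..1} h \<longleftrightarrow> p_convex (distortion_riskmetric h)) \<and>
         (convex_on {0..1} h \<longleftrightarrow> p_quasi_convex (distortion_riskmetric h))"
proof -
  interpret prob_space M by fact
  have h0: "h 0 = 0" using assms(3) by (simp add: H_BV_def)
  obtain B where B: "\<And>x. x \<in> {0..1} \<Longrightarrow> \<bar>h x\<bar> \<le> B" using H_BV_bounded[OF assms(3)] by blast
  have mid: "convex_on {0..1} h" if "\<And>s t. 0 \<le> s \<Longrightarrow> s \<le> t \<Longrightarrow> t \<le> 1 \<Longrightarrow> h ((s + t) / 2) \<le> (h s + h t) / 2"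
    using that B by (intro midpoint_convex_imp_convex_on[where B = B]) (auto simp: abs_le_iff)
  have i_ii: "concave_order_monotone (distortion_riskmetric h)" if "convex_on {0..1} h"
    using h0 that B by (rule convex_imp_concave_order_monotone)
  have ii_i: "convex_on {0..1} h" if "concave_order_monotone (distortion_riskmetric h)"
    using concave_order_monotone_imp_midpoint[OF assms(2) h0 that] by (rule mid)
  have i_iii: "o_superadditive M (distortion_riskmetric h)" if "convex_on {0..1} h"
    unfolding o_superadditive_def using convex_imp_superadditive[where a = 1 and b = 1, OF _ _ _ _ h0 that B] by simp
  have iii_i: "convex_on {0..1} h" if "o_superadditive M (distortion_riskmetric h)"
    using o_superadditive_imp_midpoint[OF assms(2) h0 that] by (rule mid)
  have i_iv: "o_concave M (distortion_riskmetric h)" if "convex_on {0..1} h"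
    unfolding o_concave_def by (intro ballI convex_imp_superadditive[OF _ _ _ _ h0 that B]) auto
  \<comment> \<open>Conditions (iv) and (vi) return to (i) through their weaker versions (v) and
    (vii): a convex combination lies between the minimum and the maximum.\<close>
  have iv_v: "o_quasi_concave M (distortion_riskmetric h)" if conc: "o_concave M (distortion_riskmetric h)"
    unfolding o_quasi_concave_def
  proof (intro ballI)
    fix X Y and \<alpha> :: real assume X: "X \<in> compact_rvs M" and Y: "Y \<in> compact_rvs M" and \<alpha>: "\<alpha> \<in> {0..1}"
    let ?x = "distortion_riskmetric h (distr M borel X)" and ?y = "distortion_riskmetric h (distr M borel Y)"
    have "\<alpha> * min ?x ?y + (1 - \<alpha>) * min ?x ?y \<le> \<alpha> * ?x + (1 - \<alpha>) * ?y"
      using \<alpha> by (intro add_mono mult_left_mono) auto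
    also have "\<dots> \<le> distortion_riskmetric h (distr M borel (\<lambda>\<omega>. \<alpha> * X \<omega> + (1 - \<alpha>) * Y \<omega>))"
      using conc X Y \<alpha> unfolding o_concave_def by blast
    finally show "min ?x ?y \<le> distortion_riskmetric h (distr M borel (\<lambda>\<omega>. \<alpha> * X \<omega> + (1 - \<alpha>) * Y \<omega>))"
      by (simp add: left_diff_distrib)
  qed
  have v_i: "convex_on {0..1} h" if "o_quasi_concave M (distortion_riskmetric h)"
    using o_quasi_concave_imp_midpoint[OF assms(2) h0 that] by (rule mid)
  have i_vi: "p_convex (distortion_riskmetric h)" if "convex_on {0..1} h"
    using h0 that B by (rule convex_imp_p_convex)
  have vi_vii: "p_quasi_convex (distortion_riskmetric h)" if conv: "p_convex (distortion_riskmetric h)"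
    unfolding p_quasi_convex_def
  proof (intro ballI)
    fix F G and \<alpha> :: real
    assume F: "F \<in> compact_distributions" and G: "G \<in> compact_distributions" and \<alpha>: "\<alpha> \<in> {0..1}"
    let ?x = "distortion_riskmetric h F" and ?y = "distortion_riskmetric h G"
    have "distortion_riskmetric h (mixture \<alpha> F G) \<le> \<alpha> * ?x + (1 - \<alpha>) * ?y"
      using conv F G \<alpha> unfolding p_convex_def by blast
    also have "\<dots> \<le> \<alpha> * max ?x ?y + (1 - \<alpha>) * max ?x ?y"
      using \<alpha> by (intro add_mono mult_left_mono) auto
    finally show "distortion_riskmetric h (mixture \<alpha> F G) \<le> max ?x ?y"
      by (simp add: left_diff_distrib)
  qed
  have vii_i: "convex_on {0..1} h" if "p_quasi_convex (distortion_riskmetric h)"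
    using assms(4) p_quasi_convex_continuous_imp_convex[OF that h0] p_quasi_convex_monotone_imp_convex[OF that h0]
    by blast
  show ?thesis
    using i_ii ii_i i_iii iii_i i_iv iv_v v_i i_vi vi_vii vii_i by blast
qed

end
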